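(* Let $(\mathbb{I},J,\omega)$ be the almost-Kähler Iwasawa manifold described in the context. Then $h^{1,0}_{\overline{\partial}}=1$ (spanned by $\varphi^3$), $h^{2,0}_{\overline{\partial}}=1$ (spanned by $i\varphi^1\wedge\varphi^3+\varphi^2\wedge\varphi^3$), and $h^{3,0}_{\overline{\partial}}=1$ (spanned by $\varphi^1\wedge\varphi^2\wedge\varphi^3$).
   Context: General notions. For an almost-complex manifold $(X,J)$, $d=\mu+\partial+\overline{\partial}+\bar\mu$ on $A^{p,q}$ with $\overline{\partial}:A^{p,q}\to A^{p,q+1}$ the $(p,q+1)$-component of $d$. For $X$ compact, $h^{p,0}_{\overline{\partial}}$ denotes the complex dimension of $\{\psi\in A^{p,0}(X):\overline{\partial}\psi=0\}$. The Iwasawa manifold. $\mathbb{H}_3$ is the complex Heisenberg group of matrices $\begin{pmatrix}1&z_1&z_3\\0&1&z_2\\0&0&1\end{pmatrix}$, $z_j=x_j+iy_j\in\mathbb{C}$, $\Gamma\subset\mathbb{H}_3$ the subgroup with $z_1,z_2,z_3\in\mathbb{Z}[i]$, and $\mathbb{I}=\Gamma\backslash\mathbb{H}_3$. Left-invariant real $1$-forms: $e^1=dx_1$, $e^2=dy_1$, $e^3=dx_2$, $e^4=dy_2$, $e^5=dx_3-x_1dx_2+y_1dy_2$, $e^6=dy_3-x_1dy_2-y_1dx_2$, with $de^1=\dots=de^4=0$, $de^5=-e^{13}+e^{24}$, $de^6=-e^{14}-e^{23}$. $J$ is the almost-complex structure whose $(1,0)$-forms are spanned by $\varphi^1=e^1+ie^6$,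 $\varphi^2=e^2+ie^5$, $\varphi^3=e^3+ie^4$, and $\omega=\frac{i}{2}\sum_{j=1}^3\varphi^j\wedge\overline{\varphi^j}$, which is a $J$-compatible symplectic form, so $(\mathbb{I},J,\omega)$ is almost-Kähler. *)

theory Defs
  imports "HOL-Analysis.Analysis"
begin

(* Points of the complex Heisenberg group H_3, via the coordinates (z1,z2,z3)
   of the matrix [[1,z1,z3],[0,1,z2],[0,0,1]].  As a real manifold H_3 = R^6. *)
type_synonym pt = "complex \<times> complex \<times> complex"

(* group law of H_3 (matrix multiplication in these coordinates) *)
definition Hmul :: "pt \<Rightarrow> pt \<Rightarrow> pt" where
  "Hmul a z = (fst a + fst z, fst (snd a) + fst (snd z),
               snd (snd a) + snd (snd z) + fst a * fst (snd z))"

definition gaussian_int :: "complex \<Rightarrow> bool" where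
  "gaussian_int c \<longleftrightarrow> Re c \<in> \<int> \<and> Im c \<in> \<int>"

definition Gamma :: "pt set" where
  "Gamma = {a. gaussian_int (fst a) \<and> gaussian_int (fst (snd a)) \<and> gaussian_int (snd (snd a))}"

coinductive Cinf :: "('a::real_normed_vector \<Rightarrow> 'b::real_normed_vector) \<Rightarrow> bool" where
  "(\<forall>x. f differentiable (at x)) \<Longrightarrow> (\<forall>v. Cinf (\<lambda>x. frechet_derivative f (at x) v)) \<Longrightarrow> Cinf f"

(* complex-valued differential forms on H_3 = R^6: at each point, a function of a
   list of (real) tangent vectors; a k-form is alternating k-multilinear
   on lists of length k and 0 on lists of other lengths *)
type_synonym cform = "pt \<Rightarrow> pt list \<Rightarrow> complex"
type_synonym covec = "pt \<Rightarrow> complex"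

(* wedge product of covectors, convention (a1 ^ ... ^ ak)(v1..vk) = det[a_i(v_j)] *)
definition wedge :: "covec list \<Rightarrow> pt list \<Rightarrow> complex" where
  "wedge as vs = (if length vs = length as then
      (\<Sum>p\<in>{p. p permutes {..<length as}}. of_int (sign p) * (\<Prod>i<length as. (as ! i) (vs ! p i)))
    else 0)"

(* exterior derivative (invariant formula with constant vector fields on R^6) *)
definition ext_d :: "cform \<Rightarrow> cform" where
  "ext_d \<omega> x vs = (\<Sum>i<length vs. (-1) ^ i *
      frechet_derivative (\<lambda>y. \<omega> y (take i vs @ drop (Suc i) vs)) (at x) (vs ! i))"

definition pullback :: "(pt \<Rightarrow> pt) \<Rightarrow> cform \<Rightarrow> cform" where
  "pullback F \<omega> x vs = \<omega> (F x) (map (frechet_derivative F (at x)) vs)"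

(* real coordinates x1,y1,x2,y2,x3,y3 and the left-invariant real coframe e^1..e^6 *)
definition e1 :: "pt \<Rightarrow> covec" where "e1 x v = complex_of_real (Re (fst v))"
definition e2 :: "pt \<Rightarrow> covec" where "e2 x v = complex_of_real (Im (fst v))"
definition e3 :: "pt \<Rightarrow> covec" where "e3 x v = complex_of_real (Re (fst (snd v)))"
definition e4 :: "pt \<Rightarrow> covec" where "e4 x v = complex_of_real (Im (fst (snd v)))"
definition e5 :: "pt \<Rightarrow> covec" where
  "e5 x v = complex_of_real (Re (snd (snd v)) - Re (fst x) * Re (fst (snd v)) + Im (fst x) * Im (fst (snd v)))"
definition e6 :: "pt \<Rightarrow> covec" where
  "e6 x v = complex_of_real (Im (snd (snd v)) - Re (fst x) * Im (fst (snd v)) - Im (fst x) * Re (fst (snd v)))"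

(* the (1,0)-coframe of J: phi^1 = e^1 + i e^6, phi^2 = e^2 + i e^5, phi^3 = e^3 + i e^4 *)
definition phi :: "nat \<Rightarrow> pt \<Rightarrow> covec" where
  "phi j x v = (if j = 1 then e1 x v + \<i> * e6 x v
                else if j = 2 then e2 x v + \<i> * e5 x v
                else e3 x v + \<i> * e4 x v)"

definition phibar :: "nat \<Rightarrow> pt \<Rightarrow> covec" where
  "phibar j x v = cnj (phi j x v)"

definition lin_span_c :: "(pt list \<Rightarrow> complex) set \<Rightarrow> (pt list \<Rightarrow> complex) set" where
  "lin_span_c S = {\<lambda>vs. \<Sum>i<(n::nat). c i * g i vs | n c g. \<forall>i<n. g i \<in> S}"

definition gens :: "nat \<Rightarrow> nat \<Rightarrow> pt \<Rightarrow> (pt list \<Rightarrow> complex) set" where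
  "gens p q x = {wedge (map (\<lambda>j. phi j x) I @ map (\<lambda>j. phibar j x) K) | I K.
      set I \<subseteq> {1,2,3} \<and> set K \<subseteq> {1,2,3} \<and> length I = p \<and> length K = q}"

definition Lam :: "nat \<Rightarrow> nat \<Rightarrow> pt \<Rightarrow> (pt list \<Rightarrow> complex) set" where
  "Lam p q x = lin_span_c (gens p q x)"

(* (r,s)-component of a (r+s)-covector, w.r.t. Lambda^{r+s} = direct sum of Lambda^{a,b} *)
definition bidegree_comp :: "nat \<Rightarrow> nat \<Rightarrow> pt \<Rightarrow> (pt list \<Rightarrow> complex) \<Rightarrow> (pt list \<Rightarrow> complex)" where
  "bidegree_comp r s x \<eta> = (THE \<theta>. \<theta> \<in> Lam r s x \<and>
      (\<lambda>vs. \<eta> vs - \<theta> vs) \<in> lin_span_c (\<Union>{gens a b x | a b. a + b = r + s \<and> (a, b) \<noteq> (r, s)}))"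

definition dbar :: "nat \<Rightarrow> nat \<Rightarrow> cform \<Rightarrow> cform" where
  "dbar p q \<omega> x = bidegree_comp p (Suc q) x (ext_d \<omega> x)"

(* A^{p,q}(I): smooth (p,q)-forms on H_3 invariant under left translation by Gamma,
   i.e. smooth (p,q)-forms on the Iwasawa manifold Gamma\H_3 *)
definition Apq :: "nat \<Rightarrow> nat \<Rightarrow> cform set" where
  "Apq p q = {\<omega>. (\<forall>vs. Cinf (\<lambda>x. \<omega> x vs)) \<and> (\<forall>x. \<omega> x \<in> Lam p q x)
              \<and> (\<forall>\<gamma>\<in>Gamma. pullback (Hmul \<gamma>) \<omega> = \<omega>)}"

(* the space whose complex dimension is h^{p,0}_dbar *)
definition dbar_closed_p0 :: "nat \<Rightarrow> cform set" where
  "dbar_closed_p0 p = {\<psi> \<in> Apq p 0. dbar p 0 \<psi> = (\<lambda>x vs. 0)}"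

definition cline :: "cform \<Rightarrow> cform set" where
  "cline \<psi> = {\<lambda>x vs. c * \<psi> x vs | c. True}"

end

theory Submission
  imports "Jordan_Normal_Form.Determinant" "HOL-Complex_Analysis.Cauchy_Integral_Formula" Defs
begin

text \<open>
  Write a \<open>(p,0)\<close>-form on the quotient as a combination of wedge products of the \<open>phi j\<close>. Its
  coefficients are functions on \<open>\<complex>\<^sup>3\<close> invariant under \<open>Gamma\<close>, hence bounded, and the structure
  equations turn \<open>dbar \<psi> = 0\<close> into a first-order system for the derivatives of the coefficients
  along the complex vector fields dual to the \<open>phibar k\<close>. Through every point each of these fields
  is the Cauchy-Riemann operator of a complex line in \<open>\<complex>\<^sup>3\<close>. A bounded function on the plane whose
  Cauchy-Riemann derivative is a constant \<open>c\<close> is itself constant and \<open>c = 0\<close>: subtracting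
  \<open>c/2\<close> times the conjugate variable gives an entire function of at most linear growth. Applied
  to suitable combinations of the coefficients, this forces all of them to be constant and leaves
  a one-dimensional solution space in each degree.
\<close>

section \<open>The wedge product as iterated exterior multiplication\<close>

text \<open>The zeroth-order terms of the system are the (1,1)-parts of the differentials of
  \<open>phi 1\<close> and \<open>phi 2\<close>. Along \<open>Vbarfield 3\<close> they act on the
  coefficients of \<open>phi 1\<close> and \<open>phi 2\<close> by a quarter of the matrix with rows
  (1, -\<i>) and (-\<i>, -1), whose square is zero; wedging with \<open>phi 3\<close> leaves the
  same matrix in degree two. Nilpotency is why a constant right-hand side must be allowed: one
  combination of the coefficients is constant and is, up to a factor, the derivative of the other.
  The kernel is spanned by (\<i>, 1), the origin of the form \<open>\<i> * phi 1 + phi 2\<close>.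
  The (1,1)-part of its differential is a nonzero multiple of \<open>phi 3\<close>: this excludes it
  in degree one and disappears after wedging with \<open>phi 3\<close> in degree two. In degree
  three only the trace of the matrix could enter, and it is zero. A formal obstacle is that
  \<open>bidegree_comp\<close> is a definite description: a computed (p,1)-part is its value only
  once the sum of the bidegrees is known to be direct.\<close>

lemma nth_delete:
  assumes "i < length vs" "j < length vs - 1"
  shows "(take i vs @ drop (Suc i) vs) ! j = vs ! (if j < i then j else Suc j)"
  using assms by (auto simp: nth_append min_def)

text \<open>Exterior product of a covector with a form, written as Laplace expansion along the row
  of \<open>a\<close>. It accepts any function on lists, so the rules below need neither alternation
  nor linearity of \<open>\<eta>\<close>.\<close>

definition cwedge :: "covec \<Rightarrow> (pt list \<Rightarrow> complex) \<Rightarrow> pt list \<Rightarrow> complex" where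
  "cwedge a \<eta> vs = (\<Sum>i<length vs. (-1) ^ i * a (vs ! i) * \<eta> (take i vs @ drop (Suc i) vs))"

lemma wedge_eq_det:
  assumes "length vs = length as"
  shows "wedge as vs = Determinant.det (Matrix.mat (length as) (length as) (\<lambda>(i, j). (as ! i) (vs ! j)))"
proof -
  have "wedge as vs = (\<Sum>p | p permutes {0..<length as}.
      of_int (sign p) * (\<Prod>i = 0..<length as. (as ! i) (vs ! p i)))"
    using assms by (simp add: wedge_def lessThan_atLeast0)
  also have "\<dots> = Determinant.det (Matrix.mat (length as) (length as) (\<lambda>(i, j). (as ! i) (vs ! j)))"
    unfolding Determinant.det_def
    by (auto intro!: sum.cong prod.cong simp: permutes_in_image[of _ "{0..<length as}"] sign_def)
  finally show ?thesis .
qed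

lemma wedge_Cons: "wedge (a # as) = cwedge a (wedge as)"
proof
  fix vs
  show "wedge (a # as) vs = cwedge a (wedge as) vs"
  proof (cases "length vs = Suc (length as)")
    case True
    define n where "n = length as"
    define A where "A = Matrix.mat (Suc n) (Suc n) (\<lambda>(i, j). ((a # as) ! i) (vs ! j))"
    have A: "A \<in> carrier_mat (Suc n) (Suc n)" by (simp add: A_def)
    have "wedge (a # as) vs = Determinant.det A"
      using True by (simp add: wedge_eq_det A_def n_def)
    also have "\<dots> = (\<Sum>j<Suc n. A $$ (0, j) * cofactor A 0 j)"
      by (rule laplace_expansion_row[OF A]) simp
    also have "\<dots> = cwedge a (wedge as) vs"
      unfolding cwedge_def True n_def[symmetric]
    proof (rule sum.cong[OF refl])
      fix j assume j: "j \<in> {..<Suc n}"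
      have "mat_delete A 0 j = Matrix.mat n n (\<lambda>(i, k). (as ! i) ((take j vs @ drop (Suc j) vs) ! k))"
        using j True by (intro eq_matI) (auto simp: mat_delete_def A_def nth_delete n_def nth_append min_def)
      moreover have "wedge as (take j vs @ drop (Suc j) vs) =
          Determinant.det (Matrix.mat n n (\<lambda>(i, k). (as ! i) ((take j vs @ drop (Suc j) vs) ! k)))"
        using j True by (subst wedge_eq_det) (auto simp: n_def)
      ultimately show "A $$ (0, j) * cofactor A 0 j =
          (- 1) ^ j * a (vs ! j) * wedge as (take j vs @ drop (Suc j) vs)"
        using j by (simp add: cofactor_def A_def)
    qed
    finally show ?thesis .
  next
    case False
    then have "wedge (a # as) vs = 0" by (simp add: wedge_def)
    moreover have "cwedge a (wedge as) vs = 0"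
      unfolding cwedge_def
    proof (rule sum.neutral, rule ballI)
      fix i assume "i \<in> {..<length vs}"
      then show "(- 1) ^ i * a (vs ! i) * wedge as (take i vs @ drop (Suc i) vs) = 0"
        using False by (auto simp: wedge_def)
    qed
    ultimately show ?thesis by simp
  qed
qed

lemma wedge_Nil: "wedge [] vs = (if vs = [] then 1 else 0)"
  by (simp add: wedge_def)

lemma cwedge_Nil [simp]: "cwedge a \<eta> [] = 0"
  by (simp add: cwedge_def)

text \<open>The antiderivation rule for interior multiplication by \<open>u\<close>; the minus sign
  arises because all later deletion indices shift by one.\<close>

lemma cwedge_Cons:
  "cwedge a \<eta> (u # l) = a u * \<eta> l - cwedge a (\<lambda>l'. \<eta> (u # l')) l"
  unfolding cwedge_def
  by (simp add: sum.lessThan_Suc_shift sum_negf del: sum.lessThan_Suc)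

lemma cwedge_zero: "cwedge a (\<lambda>vs. 0) vs = 0"
  and cwedge_add: "cwedge a (\<lambda>vs. \<eta> vs + \<theta> vs) vs = cwedge a \<eta> vs + cwedge a \<theta> vs"
  and cwedge_diff: "cwedge a (\<lambda>vs. \<eta> vs - \<theta> vs) vs = cwedge a \<eta> vs - cwedge a \<theta> vs"
  and cwedge_minus: "cwedge a (\<lambda>vs. - \<eta> vs) vs = - cwedge a \<eta> vs"
  and cwedge_scale: "cwedge a (\<lambda>vs. c * \<eta> vs) vs = c * cwedge a \<eta> vs"
  and cwedge_divide: "cwedge a (\<lambda>vs. \<eta> vs / c) vs = cwedge a \<eta> vs / c"
  by (simp_all add: cwedge_def algebra_simps sum.distrib sum_subtractf sum_negf
      sum_distrib_left sum_divide_distrib add_divide_distrib)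

lemmas cwedge_linear = cwedge_zero cwedge_add cwedge_diff cwedge_minus cwedge_scale cwedge_divide

text \<open>Alternating sum over ordered choices of two entries, where \<open>j\<close> is counted
  after entry \<open>i\<close> has been removed. With a product of covectors in \<open>T\<close> it
  is an iterated exterior product, with a derivative in \<open>T\<close> a term of the Leibniz rule,
  so one antisymmetry serves both.\<close>

definition dsum :: "(pt \<Rightarrow> pt \<Rightarrow> pt list \<Rightarrow> complex) \<Rightarrow> pt list \<Rightarrow> complex" where
  "dsum T vs = (\<Sum>i<length vs. \<Sum>j<length vs - 1. (-1) ^ (i + j) *
     (let ws = take i vs @ drop (Suc i) vs in T (vs ! i) (ws ! j) (take j ws @ drop (Suc j) ws)))"

lemma delete_delete_swap:
  assumes "j < i" "i < length vs"
  shows "take j (take i vs @ drop (Suc i) vs) @ drop (Suc j) (take i vs @ drop (Suc i) vs) =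
    take (i - 1) (take j vs @ drop (Suc j) vs) @ drop i (take j vs @ drop (Suc j) vs)"
proof (rule nth_equalityI)
  fix k
  assume "k < length (take j (take i vs @ drop (Suc i) vs) @ drop (Suc j) (take i vs @ drop (Suc i) vs))"
  then have k: "k < length vs - 2" using assms by simp
  have i: "drop i (take j vs @ drop (Suc j) vs) = drop (Suc (i - 1)) (take j vs @ drop (Suc j) vs)"
    using assms by simp
  show "(take j (take i vs @ drop (Suc i) vs) @ drop (Suc j) (take i vs @ drop (Suc i) vs)) ! k =
    (take (i - 1) (take j vs @ drop (Suc j) vs) @ drop i (take j vs @ drop (Suc j) vs)) ! k"
    unfolding i using assms k by (subst (1 2) nth_delete) (auto simp: nth_delete)
qed (use assms in auto)

text \<open>Removing the same two entries in the opposite order leaves the same rest, but one of the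
  indices moves by one and the sign flips. The involution \<open>h\<close> matches the two orders,
  as in the cancellation behind d d = 0.\<close>

lemma dsum_swap: "dsum T vs = - dsum (\<lambda>u v. T v u) vs"
proof -
  define n where "n = length vs"
  define h where "h = (\<lambda>(i::nat, j::nat). if j < i then (j, i - 1) else (Suc j, i))"
  define G where "G = (\<lambda>T (i, j). (-1) ^ (i + j) *
     (let ws = take i vs @ drop (Suc i) vs
      in (T :: pt \<Rightarrow> pt \<Rightarrow> pt list \<Rightarrow> complex) (vs ! i) (ws ! j) (take j ws @ drop (Suc j) ws)))"
  have dsum_G: "dsum T vs = sum (G T) ({..<n} \<times> {..<n - 1})" for T
    unfolding dsum_def G_def n_def sum.cartesian_product ..
  have 1: "G (\<lambda>u v. T v u) (j, i - 1) = - G T (i, j)" if "j < i" "i < n" for i j T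
  proof -
    have "(-1) ^ (i + j) = - ((-1) ^ (j + (i - 1)) :: complex)"
      using that by (cases i) (auto simp: add.commute)
    then show ?thesis
      using that delete_delete_swap[of j i vs] unfolding G_def n_def
      by (auto simp: Let_def nth_delete)
  qed
  have 2: "G (\<lambda>u v. T v u) (Suc j, i) = - G T (i, j)" if "\<not> j < i" "j < n - 1" for i j
    using 1[of i "Suc j" "\<lambda>u v. T v u"] that by simp
  have "sum (G T) ({..<n} \<times> {..<n - 1}) = sum (\<lambda>x. - G (\<lambda>u v. T v u) x) ({..<n} \<times> {..<n - 1})"
    by (rule sum.reindex_bij_witness[where i = h and j = h])
       (auto simp: h_def 1[simplified] 2 split: if_splits)
  then show ?thesis by (simp add: dsum_G sum_negf)
qed

lemma cwedge_cwedge: "cwedge a (cwedge b \<eta>) vs = dsum (\<lambda>u v l. a u * b v * \<eta> l) vs"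
proof -
  have "(-1) ^ i * a (vs ! i) * cwedge b \<eta> (take i vs @ drop (Suc i) vs) =
    (\<Sum>j<length vs - 1. (-1) ^ (i + j) * (let ws = take i vs @ drop (Suc i) vs
      in a (vs ! i) * b (ws ! j) * \<eta> (take j ws @ drop (Suc j) ws)))"
    if "i < length vs" for i
  proof -
    have "length (take i vs @ drop (Suc i) vs) = length vs - 1" using that by auto
    then show ?thesis
      unfolding cwedge_def Let_def sum_distrib_left
      by (intro sum.cong) (auto simp: power_add)
  qed
  then show ?thesis
    unfolding dsum_def cwedge_def[of a] by (intro sum.cong) auto
qed

lemma cwedge_anticommute: "cwedge a (cwedge b \<eta>) = (\<lambda>vs. - cwedge b (cwedge a \<eta>) vs)"
  unfolding cwedge_cwedge by (subst dsum_swap) (simp add: mult.commute mult.left_commute)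

lemma cwedge_square: "cwedge a (cwedge a \<eta>) = (\<lambda>vs. 0)"
  using cwedge_anticommute[of a a \<eta>] by (auto simp: fun_eq_iff)

section \<open>The decomposition into bidegrees\<close>

lemma lin_span_c_zero: "(\<lambda>vs. 0) \<in> lin_span_c S"
  unfolding lin_span_c_def by (rule CollectI, rule exI[of _ 0]) auto

lemma lin_span_cI:
  "(\<And>i. i < n \<Longrightarrow> g i \<in> S) \<Longrightarrow> (\<lambda>vs. \<Sum>i<(n::nat). c i * g i vs) \<in> lin_span_c S"
  unfolding lin_span_c_def by (intro CollectI exI conjI allI impI) auto

lemma lin_span_c_add_gen:
  assumes "\<eta> \<in> lin_span_c S" "g \<in> S"
  shows "(\<lambda>vs. \<eta> vs + a * g vs) \<in> lin_span_c S"
proof -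
  obtain n c h where \<eta>: "\<eta> = (\<lambda>vs. \<Sum>i<(n::nat). c i * h i vs)" and h: "\<forall>i<n. h i \<in> S"
    using assms(1) unfolding lin_span_c_def by blast
  have "(\<lambda>vs. \<eta> vs + a * g vs) = (\<lambda>vs. \<Sum>i<Suc n. (c(n := a)) i * (h(n := g)) i vs)"
    by (auto simp: \<eta>)
  also have "\<dots> \<in> lin_span_c S"
    using h assms(2) by (intro lin_span_cI) auto
  finally show ?thesis .
qed

lemma lin_span_c_induct [consumes 1, case_names zero add]:
  assumes "\<eta> \<in> lin_span_c S"
    and zero: "P (\<lambda>vs. 0)"
    and add: "\<And>\<eta> a g. \<eta> \<in> lin_span_c S \<Longrightarrow> P \<eta> \<Longrightarrow> g \<in> S \<Longrightarrow> P (\<lambda>vs. \<eta> vs + a * g vs)"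
  shows "P \<eta>"
proof -
  obtain n c h where \<eta>: "\<eta> = (\<lambda>vs. \<Sum>i<(n::nat). c i * h i vs)" and h: "\<forall>i<n. h i \<in> S"
    using assms(1) unfolding lin_span_c_def by blast
  have "P (\<lambda>vs. \<Sum>i<m. c i * h i vs)" if "m \<le> n" for m
    using that
  proof (induction m)
    case (Suc m)
    have "(\<lambda>vs. \<Sum>i<m. c i * h i vs) \<in> lin_span_c S"
      using h Suc.prems by (intro lin_span_cI) auto
    then show ?case using Suc h add[of "\<lambda>vs. \<Sum>i<m. c i * h i vs" "h m" "c m"] by simp
  qed (simp add: zero)
  then show ?thesis by (simp add: \<eta>)
qed

lemma lin_span_c_base: "g \<in> S \<Longrightarrow> g \<in> lin_span_c S"
  using lin_span_c_add_gen[OF lin_span_c_zero, of g S 1] by simp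

lemma lin_span_c_add_scaled:
  assumes "\<eta> \<in> lin_span_c S" "\<theta> \<in> lin_span_c S"
  shows "(\<lambda>vs. \<eta> vs + a * \<theta> vs) \<in> lin_span_c S"
  using assms(2)
proof (induction \<theta> rule: lin_span_c_induct)
  case zero
  then show ?case using assms(1) by simp
next
  case (add \<theta> b g)
  then show ?case using lin_span_c_add_gen[OF add.IH add.hyps(2), of "a * b"] by (simp add: algebra_simps)
qed

lemma lin_span_c_scale: "\<eta> \<in> lin_span_c S \<Longrightarrow> (\<lambda>vs. a * \<eta> vs) \<in> lin_span_c S"
  using lin_span_c_add_scaled[OF lin_span_c_zero] by simp

lemma lin_span_c_divide: "\<eta> \<in> lin_span_c S \<Longrightarrow> (\<lambda>vs. \<eta> vs / a) \<in> lin_span_c S"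
  using lin_span_c_scale[of \<eta> S "1 / a"] by simp

lemma lin_span_c_minus: "\<eta> \<in> lin_span_c S \<Longrightarrow> (\<lambda>vs. - \<eta> vs) \<in> lin_span_c S"
  using lin_span_c_scale[of \<eta> S "-1"] by simp

lemma lin_span_c_add:
  "\<eta> \<in> lin_span_c S \<Longrightarrow> \<theta> \<in> lin_span_c S \<Longrightarrow> (\<lambda>vs. \<eta> vs + \<theta> vs) \<in> lin_span_c S"
  using lin_span_c_add_scaled[of \<eta> S \<theta> 1] by simp

lemma lin_span_c_diff:
  "\<eta> \<in> lin_span_c S \<Longrightarrow> \<theta> \<in> lin_span_c S \<Longrightarrow> (\<lambda>vs. \<eta> vs - \<theta> vs) \<in> lin_span_c S"
  using lin_span_c_add_scaled[of \<eta> S \<theta> "-1"] by simp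

lemmas lin_span_c_intros = lin_span_c_zero lin_span_c_add lin_span_c_diff lin_span_c_minus
  lin_span_c_scale lin_span_c_divide

lemma lin_span_c_cwedge:
  assumes "\<eta> \<in> lin_span_c S" "\<And>g. g \<in> S \<Longrightarrow> cwedge a g \<in> lin_span_c S'"
  shows "cwedge a \<eta> \<in> lin_span_c S'"
  using assms(1)
proof (induction \<eta> rule: lin_span_c_induct)
  case zero
  then show ?case using lin_span_c_zero by (simp add: cwedge_zero[abs_def])
next
  case (add \<eta> b g)
  have "cwedge a (\<lambda>vs. \<eta> vs + b * g vs) = (\<lambda>vs. cwedge a \<eta> vs + b * cwedge a g vs)"
    by (auto simp: cwedge_linear)
  then show ?case using lin_span_c_add_scaled[OF add.IH assms(2)[OF add.hyps(2)]] by simp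
qed

section \<open>Effect of exterior multiplication on the bidegree\<close>

lemma cwedge_phi_gens:
  assumes "g \<in> gens p q x" "j \<in> {1, 2, 3}"
  shows "cwedge (phi j x) g \<in> gens (Suc p) q x"
proof -
  obtain I K where g: "g = wedge (map (\<lambda>j. phi j x) I @ map (\<lambda>j. phibar j x) K)"
    and IK: "set I \<subseteq> {1,2,3}" "set K \<subseteq> {1,2,3}" "length I = p" "length K = q"
    using assms(1) unfolding gens_def by blast
  have "cwedge (phi j x) g = wedge (map (\<lambda>j. phi j x) (j # I) @ map (\<lambda>j. phibar j x) K)"
    by (simp add: g wedge_Cons)
  moreover have "set (j # I) \<subseteq> {1,2,3}" "length (j # I) = Suc p"
    using IK assms(2) by auto
  ultimately show ?thesis unfolding gens_def using IK by blast
qed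

lemma cwedge_wedge_append:
  "cwedge a (wedge (as @ bs)) = (\<lambda>vs. (-1) ^ length as * wedge (as @ a # bs) vs)"
proof (induction as)
  case Nil
  then show ?case by (simp add: wedge_Cons)
next
  case (Cons b as)
  then show ?case
    by (auto simp: wedge_Cons cwedge_anticommute[of a b] cwedge_linear)
qed

text \<open>In \<open>gens\<close> the unbarred factors stand first, so a new barred factor has to
  pass \<open>p\<close> of them; because of the resulting sign only membership in the span is
  claimed.\<close>

lemma cwedge_phibar_gens:
  assumes "g \<in> gens p q x" "j \<in> {1, 2, 3}"
  shows "cwedge (phibar j x) g \<in> lin_span_c (gens p (Suc q) x)"
proof -
  obtain I K where g: "g = wedge (map (\<lambda>j. phi j x) I @ map (\<lambda>j. phibar j x) K)"
    and IK: "set I \<subseteq> {1,2,3}" "set K \<subseteq> {1,2,3}" "length I = p" "length K = q"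
    using assms(1) unfolding gens_def by blast
  have "cwedge (phibar j x) g = (\<lambda>vs. (-1) ^ p *
      wedge (map (\<lambda>j. phi j x) I @ map (\<lambda>j. phibar j x) (j # K)) vs)"
    using IK by (simp add: g cwedge_wedge_append)
  moreover have "set (j # K) \<subseteq> {1,2,3}" "length (j # K) = Suc q"
    using IK assms(2) by auto
  then have "wedge (map (\<lambda>j. phi j x) I @ map (\<lambda>j. phibar j x) (j # K)) \<in> gens p (Suc q) x"
    unfolding gens_def using IK by blast
  ultimately show ?thesis by (simp add: lin_span_c_scale[OF lin_span_c_base])
qed

lemma cwedge_phi_Lam: "\<eta> \<in> Lam p q x \<Longrightarrow> j \<in> {1,2,3} \<Longrightarrow> cwedge (phi j x) \<eta> \<in> Lam (Suc p) q x"
  unfolding Lam_def by (erule lin_span_c_cwedge) (blast intro: lin_span_c_base cwedge_phi_gens)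

lemma cwedge_phibar_Lam: "\<eta> \<in> Lam p q x \<Longrightarrow> j \<in> {1,2,3} \<Longrightarrow> cwedge (phibar j x) \<eta> \<in> Lam p (Suc q) x"
  unfolding Lam_def by (erule lin_span_c_cwedge) (blast intro: cwedge_phibar_gens)

text \<open>Literally the remainder space in the definition of \<open>bidegree_comp\<close>.\<close>

definition Lam_compl :: "nat \<Rightarrow> nat \<Rightarrow> pt \<Rightarrow> (pt list \<Rightarrow> complex) set" where
  "Lam_compl r s x = lin_span_c (\<Union>{gens a b x | a b. a + b = r + s \<and> (a, b) \<noteq> (r, s)})"

lemma Lam_subset_Lam_compl:
  assumes "a + b = r + s" "a \<noteq> r" "\<eta> \<in> Lam a b x"
  shows "\<eta> \<in> Lam_compl r s x"
  using assms(3) unfolding Lam_def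
proof (induction \<eta> rule: lin_span_c_induct)
  case zero
  show ?case unfolding Lam_compl_def by (rule lin_span_c_zero)
next
  case (add \<eta> c g)
  have "g \<in> \<Union>{gens a b x | a b. a + b = r + s \<and> (a, b) \<noteq> (r, s)}"
    using add.hyps(2) assms by blast
  then show ?case using add.IH unfolding Lam_compl_def by (intro lin_span_c_add_gen)
qed

lemma cwedge_phi_Lam_compl:
  assumes "\<eta> \<in> Lam_compl r s x" "j \<in> {1,2,3}"
  shows "cwedge (phi j x) \<eta> \<in> Lam_compl (Suc r) s x"
  using assms(1) unfolding Lam_compl_def
proof (rule lin_span_c_cwedge)
  fix g assume "g \<in> \<Union>{gens a b x | a b. a + b = r + s \<and> (a, b) \<noteq> (r, s)}"
  then obtain a b where g: "g \<in> gens a b x" "a + b = r + s" "(a, b) \<noteq> (r, s)" by blast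
  then have "cwedge (phi j x) g \<in> gens (Suc a) b x" using cwedge_phi_gens assms(2) by blast
  moreover have "Suc a + b = Suc r + s" "(Suc a, b) \<noteq> (Suc r, s)" using g by auto
  ultimately show "cwedge (phi j x) g \<in>
      lin_span_c (\<Union>{gens a b x | a b. a + b = Suc r + s \<and> (a, b) \<noteq> (Suc r, s)})"
    by (intro lin_span_c_base) blast
qed

text \<open>The real tangent vector at \<open>x\<close> on which \<open>phi 1\<close>, \<open>phi 2\<close>, \<open>phi 3\<close> take the values
  \<open>a\<close>, \<open>b\<close>, \<open>c\<close>; the last component uses that \<open>e5 + \<i> * e6\<close> is \<open>dz3 - z1 dz2\<close>.\<close>

definition frame :: "pt \<Rightarrow> complex \<Rightarrow> complex \<Rightarrow> complex \<Rightarrow> pt" where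
  "frame x a b c = (Complex (Re a) (Re b), c, Complex (Im b) (Im a) + fst x * c)"

lemma phi_frame:
  "phi j x (frame x a b c) = (if j = 1 then a else if j = 2 then b else c)"
  by (simp add: phi_def frame_def e1_def e2_def e3_def e4_def e5_def e6_def complex_eq_iff)

lemma frame_phi: "frame x (phi 1 x v) (phi 2 x v) (phi 3 x v) = v"
  by (cases v) (simp add: phi_def frame_def e1_def e2_def e3_def e4_def e5_def e6_def complex_eq_iff)

text \<open>Multiplication of the tangent space by \<open>\<zeta>\<close> for the structure
  \<open>J\<close>, whose (1,0)-forms are the complex-linear covectors.\<close>

definition rotate_frame :: "pt \<Rightarrow> complex \<Rightarrow> pt \<Rightarrow> pt" where
  "rotate_frame x \<zeta> v = frame x (\<zeta> * phi 1 x v) (\<zeta> * phi 2 x v) (\<zeta> * phi 3 x v)"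

lemma phi_rotate_frame: "phi j x (rotate_frame x \<zeta> v) = \<zeta> * phi j x v"
  by (simp add: rotate_frame_def phi_frame) (simp add: phi_def)

lemma wedge_scaled:
  assumes "length cs = length as" "\<And>i v. i < length as \<Longrightarrow> (as ! i) (T v) = cs ! i * (as ! i) v"
  shows "wedge as (map T vs) = prod_list cs * wedge as vs"
proof (cases "length vs = length as")
  case True
  have "(\<Prod>i<length as. (as ! i) (map T vs ! p i)) = prod_list cs * (\<Prod>i<length as. (as ! i) (vs ! p i))"
    if "p permutes {..<length as}" for p
  proof -
    have "(\<Prod>i<length as. (as ! i) (map T vs ! p i)) = (\<Prod>i<length as. cs ! i * (as ! i) (vs ! p i))"
      using assms(2) True permutes_in_image[OF that] by (intro prod.cong) auto
    also have "\<dots> = (\<Prod>i<length as. cs ! i) * (\<Prod>i<length as. (as ! i) (vs ! p i))"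
      by (rule prod.distrib)
    also have "(\<Prod>i<length as. cs ! i) = prod_list cs"
      using assms(1) by (simp add: prod.list_conv_set_nth lessThan_atLeast0)
    finally show ?thesis .
  qed
  then show ?thesis
    using True by (simp add: wedge_def sum_distrib_left algebra_simps)
qed (simp add: wedge_def)

lemma gens_rotate_frame:
  assumes "g \<in> gens a b x"
  shows "g (map (rotate_frame x \<zeta>) vs) = \<zeta> ^ a * cnj \<zeta> ^ b * g vs"
proof -
  obtain I K where g: "g = wedge (map (\<lambda>j. phi j x) I @ map (\<lambda>j. phibar j x) K)"
    and IK: "length I = a" "length K = b"
    using assms unfolding gens_def by blast
  show ?thesis unfolding g
    by (subst wedge_scaled[where cs = "replicate a \<zeta> @ replicate b (cnj \<zeta>)"])
       (auto simp: IK nth_append phi_rotate_frame phibar_def)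
qed

text \<open>Rotating the coframe by \<open>\<zeta>\<close> multiplies a form of bidegree \<open>(a,b)\<close> by \<open>\<zeta> ^ a * cnj \<zeta> ^ b\<close>,
  so averaging over roots of unity isolates a single bidegree and shows that the sum is direct.\<close>

definition bidegree_average :: "nat \<Rightarrow> nat \<Rightarrow> pt \<Rightarrow> (pt list \<Rightarrow> complex) \<Rightarrow> pt list \<Rightarrow> complex" where
  "bidegree_average r s x \<eta> vs = (\<Sum>m::nat\<le>r + s. let \<zeta> = cis (pi * real m / real (Suc (r + s))) in
     cnj \<zeta> ^ r * \<zeta> ^ s * \<eta> (map (rotate_frame x \<zeta>) vs))"

lemma bidegree_average_add_scaled:
  "bidegree_average r s x (\<lambda>vs. \<eta> vs + c * \<theta> vs) vs =
     bidegree_average r s x \<eta> vs + c * bidegree_average r s x \<theta> vs"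
  by (simp add: bidegree_average_def Let_def algebra_simps sum.distrib sum_distrib_left)

lemma bidegree_average_Lam:
  assumes "\<eta> \<in> Lam r s x"
  shows "bidegree_average r s x \<eta> vs = of_nat (Suc (r + s)) * \<eta> vs"
  using assms unfolding Lam_def
proof (induction \<eta> rule: lin_span_c_induct)
  case zero
  then show ?case by (simp add: bidegree_average_def)
next
  case (add \<eta> c g)
  have "cnj (cis t) ^ r * cis t ^ s * g (map (rotate_frame x (cis t)) vs) = g vs" for t
  proof -
    have "cnj (cis t) ^ r * cis t ^ s * g (map (rotate_frame x (cis t)) vs) =
       (cis t * cnj (cis t)) ^ r * (cis t * cnj (cis t)) ^ s * g vs"
      unfolding gens_rotate_frame[OF add.hyps(2)] power_mult_distrib by (simp only: ac_simps)
    also have "cis t * cnj (cis t) = 1" by (simp add: cis_cnj cis_mult)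
    finally show ?thesis by simp
  qed
  then have "bidegree_average r s x g vs = (\<Sum>m\<le>r + s. g vs)"
    unfolding bidegree_average_def Let_def by (intro sum.cong refl)
  then have "bidegree_average r s x g vs = of_nat (Suc (r + s)) * g vs" by simp
  then show ?case
    unfolding bidegree_average_add_scaled add.IH by (simp only: distrib_left ac_simps)
qed

text \<open>Since a + b = r + s, the exponent of a unit \<open>\<zeta>\<close> is 2 * (a - r),
  always even, so angles \<open>pi * m / N\<close> on half a circle already produce the powers of an
  \<open>N\<close>-th root of unity \<open>q\<close>. As |a - r| < N and a \<noteq> r,
  \<open>q\<close> is not 1 and the geometric sum vanishes.\<close>

lemma bidegree_average_Lam_compl:
  assumes "\<eta> \<in> Lam_compl r s x"
  shows "bidegree_average r s x \<eta> vs = 0"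
  using assms unfolding Lam_compl_def
proof (induction \<eta> rule: lin_span_c_induct)
  case zero
  then show ?case by (simp add: bidegree_average_def)
next
  case (add \<eta> c g)
  from add.hyps(2) obtain a b where g: "g \<in> gens a b x" and ab: "a + b = r + s" "(a, b) \<noteq> (r, s)" by blast
  define N where "N = Suc (r + s)"
  define q where "q = cis (2 * pi * (real a - real r) / N)"
  have ar: "a \<noteq> r" and b: "real b = real r + real s - real a" using ab by auto
  have "cnj (cis t) ^ r * cis t ^ s * (cis t ^ a * cnj (cis t) ^ b * g vs) =
      cis (real r * - t + real s * t + real a * t + real b * - t) * g vs" for t
    unfolding cis_cnj cis_mult[symmetric] Complex.DeMoivre[of t s] Complex.DeMoivre[of t a]
      Complex.DeMoivre[of "- t" r] Complex.DeMoivre[of "- t" b] by simp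
  moreover have "real r * - t + real s * t + real a * t + real b * - t = 2 * (real a - real r) * t" for t
    unfolding b by (simp add: field_simps)
  ultimately have *: "cnj (cis t) ^ r * cis t ^ s * (cis t ^ a * cnj (cis t) ^ b * g vs) =
      cis (2 * (real a - real r) * t) * g vs" for t
    by simp
  have "bidegree_average r s x g vs = (\<Sum>m\<le>r + s. q ^ m * g vs)"
    unfolding bidegree_average_def Let_def gens_rotate_frame[OF g] *
    by (intro sum.cong refl) (simp add: q_def Complex.DeMoivre N_def field_simps)
  also have "\<dots> = (\<Sum>m<N. q ^ m * g vs)" by (simp only: N_def lessThan_Suc_atMost)
  also have "\<dots> = (\<Sum>m<N. q ^ m) * g vs" by (simp add: sum_distrib_right)
  also have "(\<Sum>m<N. q ^ m) = 0"
  proof -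
    have N0: "real N \<noteq> 0" by (simp add: N_def)
    have "q ^ N = cis (2 * pi * of_int (int a - int r))"
      unfolding q_def Complex.DeMoivre using N0 by simp
    also have "\<dots> = 1" using cis_multiple_2pi by (metis Ints_of_int)
    finally have "q ^ N = 1" .
    moreover have "q \<noteq> 1"
    proof
      assume "q = 1"
      then have "cos (2 * pi * (real a - real r) / N) = 1" by (simp add: q_def complex_eq_iff)
      then obtain k :: int where "2 * pi * (real a - real r) / N = k * 2 * pi"
        using cos_one_2pi_int by auto
      then have "(2 * pi) * (real a - real r) = (2 * pi) * (k * real N)"
        using N0 by (simp add: divide_eq_eq mult.assoc mult.left_commute)
      then have "real a - real r = k * real N" by (subst (asm) mult_cancel_left) simp
      then have "real_of_int (int a - int r) = real_of_int (k * int N)" by simp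
      then have k: "int a - int r = k * int N" by (simp only: of_int_eq_iff)
      have "\<bar>int a - int r\<bar> < int N" using ab by (auto simp: N_def)
      then have "\<bar>k\<bar> * int N < 1 * int N" unfolding k by (simp add: abs_mult)
      then have "k = 0" by (simp add: N_def mult_less_cancel_right)
      then show False using k ar by simp
    qed
    ultimately show ?thesis by (simp add: geometric_sum)
  qed
  finally have "bidegree_average r s x g vs = 0" by simp
  then show ?case using add by (simp add: bidegree_average_add_scaled)
qed

text \<open>The difference of two candidates lies in both spaces, so its average is r + s + 1 times
  itself and also zero. No independence of wedge monomials is involved.\<close>

lemma bidegree_comp_eqI:
  assumes "\<theta> \<in> Lam r s x" "(\<lambda>vs. \<eta> vs - \<theta> vs) \<in> Lam_compl r s x"
  shows "bidegree_comp r s x \<eta> = \<theta>"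
  unfolding bidegree_comp_def Lam_compl_def[symmetric]
proof (rule the_equality)
  fix \<theta>' assume \<theta>': "\<theta>' \<in> Lam r s x \<and> (\<lambda>vs. \<eta> vs - \<theta>' vs) \<in> Lam_compl r s x"
  define \<delta> where "\<delta> = (\<lambda>vs. \<theta>' vs - \<theta> vs)"
  have "\<delta> \<in> Lam r s x"
    using assms \<theta>' unfolding \<delta>_def Lam_def by (intro lin_span_c_diff) auto
  moreover have "(\<lambda>vs. (\<eta> vs - \<theta> vs) - (\<eta> vs - \<theta>' vs)) \<in> Lam_compl r s x"
    using lin_span_c_diff assms(2) \<theta>'[THEN conjunct2] unfolding Lam_compl_def by blast
  then have "\<delta> \<in> Lam_compl r s x" by (simp add: \<delta>_def)
  ultimately have "of_nat (Suc (r + s)) * \<delta> vs = 0" for vs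
    using bidegree_average_Lam[of \<delta> r s x vs] bidegree_average_Lam_compl[of \<delta> r s x vs] by simp
  then have "\<delta> vs = 0" for vs by (simp del: of_nat_Suc)
  then show "\<theta>' = \<theta>" by (auto simp: \<delta>_def fun_eq_iff)
qed (use assms in auto)

section \<open>Smoothness, invariance and Liouville's theorem\<close>

text \<open>Smoothness of polynomial expressions is proved by coinduction up to sums and products.\<close>

inductive Cinf_alg :: "('a::real_normed_vector \<Rightarrow> complex) \<Rightarrow> bool" where
  base: "Cinf f \<Longrightarrow> Cinf_alg f"
| const: "Cinf_alg (\<lambda>x. c)"
| linear: "bounded_linear f \<Longrightarrow> Cinf_alg f"
| add: "Cinf_alg f \<Longrightarrow> Cinf_alg g \<Longrightarrow> Cinf_alg (\<lambda>x. f x + g x)"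
| mult: "Cinf_alg f \<Longrightarrow> Cinf_alg g \<Longrightarrow> Cinf_alg (\<lambda>x. f x * g x)"

lemma Cinf_differentiable: "Cinf f \<Longrightarrow> f differentiable (at x)"
  by (erule Cinf.cases) auto

lemma Cinf_frechet_derivative: "Cinf f \<Longrightarrow> Cinf (\<lambda>x. frechet_derivative f (at x) v)"
  by (erule Cinf.cases) auto

text \<open>The product rule brings back the undifferentiated factors, so the class has to be closed
  under sums and products at once to be stable under differentiation; the coinduction rests on
  this.\<close>

lemma Cinf_alg_derivative:
  assumes "Cinf_alg f"
  shows "(\<forall>x. f differentiable (at x)) \<and> (\<forall>v. Cinf_alg (\<lambda>x. frechet_derivative f (at x) v))"
  using assms
proof induction
  case (base f)
  then show ?case
    by (blast intro: Cinf_alg.base Cinf_differentiable Cinf_frechet_derivative)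
next
  case (const c)
  then show ?case by (simp add: frechet_derivative_const Cinf_alg.const)
next
  case (linear f)
  then have "(f has_derivative f) (at x)" for x by (rule bounded_linear_imp_has_derivative)
  then have "f differentiable (at x)" "frechet_derivative f (at x) = f" for x
    by (auto simp: differentiable_def frechet_derivative_at[symmetric])
  then show ?case by (simp add: Cinf_alg.const)
next
  case (add f g)
  have *: "((\<lambda>x. f x + g x) has_derivative (\<lambda>v. frechet_derivative f (at x) v +
      frechet_derivative g (at x) v)) (at x)" for x
    using add.IH by (intro has_derivative_add) (auto simp: frechet_derivative_works)
  then have "(\<lambda>x. f x + g x) differentiable (at x)"
    "frechet_derivative (\<lambda>x. f x + g x) (at x) =
      (\<lambda>v. frechet_derivative f (at x) v + frechet_derivative g (at x) v)" for x
    using frechet_derivative_at[OF *] by (auto simp: differentiable_def)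
  then show ?case using add.IH by (simp add: Cinf_alg.add)
next
  case (mult f g)
  have *: "((\<lambda>x. f x * g x) has_derivative (\<lambda>v. f x * frechet_derivative g (at x) v +
      frechet_derivative f (at x) v * g x)) (at x)" for x
    using mult.IH by (intro has_derivative_mult) (auto simp: frechet_derivative_works)
  then have "(\<lambda>x. f x * g x) differentiable (at x)"
    "frechet_derivative (\<lambda>x. f x * g x) (at x) =
      (\<lambda>v. f x * frechet_derivative g (at x) v + frechet_derivative f (at x) v * g x)" for x
    using frechet_derivative_at[OF *] by (auto simp: differentiable_def)
  then show ?case using mult by (simp add: Cinf_alg.add Cinf_alg.mult)
qed

lemma Cinf_alg_imp_Cinf:
  assumes "Cinf_alg f"
  shows "Cinf f"
  using assms
proof (coinduction arbitrary: f rule: Cinf.coinduct)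
  case Cinf
  then show ?case using Cinf_alg_derivative[of f] by auto
qed

lemma Cinf_const: "Cinf (\<lambda>x::'a::real_normed_vector. c::complex)"
  by (rule Cinf_alg_imp_Cinf[OF Cinf_alg.const])

lemma Cinf_linear: "bounded_linear f \<Longrightarrow> Cinf (f :: 'a::real_normed_vector \<Rightarrow> complex)"
  by (rule Cinf_alg_imp_Cinf[OF Cinf_alg.linear])

lemma Cinf_add: "Cinf f \<Longrightarrow> Cinf g \<Longrightarrow> Cinf (\<lambda>x. f x + g x :: complex)"
  by (rule Cinf_alg_imp_Cinf[OF Cinf_alg.add[OF Cinf_alg.base Cinf_alg.base]])

lemma Cinf_mult: "Cinf f \<Longrightarrow> Cinf g \<Longrightarrow> Cinf (\<lambda>x. f x * g x :: complex)"
  by (rule Cinf_alg_imp_Cinf[OF Cinf_alg.mult[OF Cinf_alg.base Cinf_alg.base]])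

lemma Cinf_sum: "(\<And>i. i \<in> A \<Longrightarrow> Cinf (f i)) \<Longrightarrow> Cinf (\<lambda>x. \<Sum>i\<in>A. f i x :: complex)"
  by (induction A rule: infinite_finite_induct) (simp_all add: Cinf_const Cinf_add)

lemma Cinf_prod: "(\<And>i. i \<in> A \<Longrightarrow> Cinf (f i)) \<Longrightarrow> Cinf (\<lambda>x. \<Prod>i\<in>A. f i x :: complex)"
  by (induction A rule: infinite_finite_induct) (simp_all add: Cinf_const Cinf_mult)

section \<open>Smoothness and left invariance of the coframe\<close>

definition dphi :: "nat \<Rightarrow> pt \<Rightarrow> pt \<Rightarrow> complex" where
  "dphi j u v = (if j = 1 then - \<i> * of_real (Re (fst u) * Im (fst (snd v)) + Im (fst u) * Re (fst (snd v)))
     else if j = 2 then \<i> * of_real (Im (fst u) * Im (fst (snd v)) - Re (fst u) * Re (fst (snd v)))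
     else 0)"

text \<open>Only \<open>e5\<close> and \<open>e6\<close> vary with the point, and they are affine in
  its first coordinate.\<close>

lemma phi_affine: "phi j x v = dphi j x v + phi j 0 v"
  by (simp add: phi_def dphi_def e1_def e2_def e3_def e4_def e5_def e6_def complex_eq_iff)

lemma bounded_linear_dphi: "bounded_linear (\<lambda>u. dphi j u v)"
proof -
  have "bounded_linear (\<lambda>u::pt. \<i> * of_real (Re (fst u) * a + Im (fst u) * b) :: complex)" for a b
    by (rule bounded_linear_compose[OF bounded_linear_mult_right],
        rule bounded_linear_compose[OF bounded_linear_of_real],
        rule bounded_linear_add; rule bounded_linear_compose[OF bounded_linear_mult_left];
        rule bounded_linear_compose[OF bounded_linear_Re bounded_linear_fst]
          bounded_linear_compose[OF bounded_linear_Im bounded_linear_fst])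
  from this[of "- Im (fst (snd v))" "- Re (fst (snd v))"] this[of "- Re (fst (snd v))" "Im (fst (snd v))"]
  show ?thesis
    by (cases "j = 1"; cases "j = 2") (simp_all add: dphi_def algebra_simps)
qed

lemma phi_has_derivative: "((\<lambda>x. phi j x v) has_derivative (\<lambda>u. dphi j u v)) (at x)"
proof -
  have "((\<lambda>x. dphi j x v + phi j 0 v) has_derivative (\<lambda>u. dphi j u v + 0)) (at x)"
    by (rule has_derivative_add[OF bounded_linear_imp_has_derivative[OF bounded_linear_dphi]
        has_derivative_const])
  then show ?thesis by (simp flip: phi_affine)
qed

lemma Cinf_phi: "Cinf (\<lambda>x. phi j x v)"
  using Cinf_add[OF Cinf_linear[OF bounded_linear_dphi[of j v]] Cinf_const[of "phi j 0 v"]] by (simp flip: phi_affine)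

lemma Cinf_wedge_phi: "Cinf (\<lambda>x. wedge (map (\<lambda>j. phi j x) I) vs)"
proof (cases "length vs = length I")
  case True
  have "(\<lambda>x. wedge (map (\<lambda>j. phi j x) I) vs) = (\<lambda>x. \<Sum>p | p permutes {..<length I}.
      of_int (sign p) * (\<Prod>i<length I. phi (I ! i) x (vs ! p i)))"
    using True by (auto simp: wedge_def)
  then show ?thesis
    by (simp only:) (rule Cinf_sum Cinf_mult[OF Cinf_const Cinf_prod] Cinf_phi)+
qed (simp add: wedge_def Cinf_const)

lemma Hmul_has_derivative:
  "(Hmul \<gamma> has_derivative (\<lambda>v. (fst v, fst (snd v), snd (snd v) + fst \<gamma> * fst (snd v)))) (at x)"
  unfolding Hmul_def[abs_def]
  by (rule has_derivative_eq_rhs, (rule derivative_intros)+) auto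

lemma frechet_derivative_Hmul:
  "frechet_derivative (Hmul \<gamma>) (at x) v = (fst v, fst (snd v), snd (snd v) + fst \<gamma> * fst (snd v))"
  by (simp add: frechet_derivative_at[OF Hmul_has_derivative, symmetric])

text \<open>Translation by \<open>\<gamma>\<close> adds \<open>fst \<gamma>\<close> times dz2 both
  to dz3 and to z1 dz2, so their difference is unchanged.\<close>

lemma phi_Hmul: "phi j (Hmul \<gamma> x) (frechet_derivative (Hmul \<gamma>) (at x) v) = phi j x v"
  unfolding frechet_derivative_Hmul
  by (simp add: phi_def Hmul_def e1_def e2_def e3_def e4_def e5_def e6_def complex_eq_iff algebra_simps)

lemma permutes_lessThan: "p permutes {..<n} \<Longrightarrow> i < n \<Longrightarrow> p i < n"
  using permutes_in_image[of p "{..<n}" i] by simp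

lemma pullback_wedge_phi:
  "pullback (Hmul \<gamma>) (\<lambda>x. wedge (map (\<lambda>j. phi j x) I)) = (\<lambda>x. wedge (map (\<lambda>j. phi j x) I))"
proof (intro ext)
  fix x vs
  show "pullback (Hmul \<gamma>) (\<lambda>x. wedge (map (\<lambda>j. phi j x) I)) x vs = wedge (map (\<lambda>j. phi j x) I) vs"
    unfolding pullback_def wedge_def
    by (auto intro!: sum.cong prod.cong simp: phi_Hmul permutes_lessThan)
qed

text \<open>Cocompactness: every point is a \<open>Gamma\<close>-translate of a point of a fixed
  compact box.\<close>

lemma Gamma_invariant_bounded:
  fixes f :: "pt \<Rightarrow> complex"
  assumes cont: "continuous_on UNIV f"
    and inv: "\<And>\<gamma> x. \<gamma> \<in> Gamma \<Longrightarrow> f (Hmul \<gamma> x) = f x"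
  shows "bounded (range f)"
proof -
  define K where "K = cball (0::complex) 2 \<times> cball (0::complex) 2 \<times> cball (0::complex) 2"
  have "compact K" unfolding K_def by (intro compact_Times compact_cball)
  then have "bounded (f ` K)"
    using cont by (intro compact_imp_bounded compact_continuous_image) (auto intro: continuous_on_subset)
  moreover have "range f \<subseteq> f ` K"
  proof (rule image_subsetI)
    fix x :: pt
    define fl where "fl = (\<lambda>z. Complex \<lfloor>Re z\<rfloor> \<lfloor>Im z\<rfloor>)"
    have fl: "gaussian_int (fl z)" for z by (simp add: fl_def gaussian_int_def)
    have small: "norm (z - fl z) \<le> 2" for z
    proof -
      have "norm (z - fl z) \<le> \<bar>Re z - \<lfloor>Re z\<rfloor>\<bar> + \<bar>Im z - \<lfloor>Im z\<rfloor>\<bar>"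
        using cmod_le[of "z - fl z"] by (simp add: fl_def)
      then show ?thesis by linarith
    qed
    obtain a b c where x: "x = (a, b, c)" by (cases x)
    \<comment> \<open>The group law adds the cross term \<open>fl a * (b - fl b)\<close> to the
      third coordinate, so it is taken off before rounding.\<close>
    define w where "w = c - fl a * (b - fl b)"
    have "(fl a, fl b, fl w) \<in> Gamma" using fl by (simp add: Gamma_def)
    moreover have "Hmul (fl a, fl b, fl w) (a - fl a, b - fl b, w - fl w) = x"
      by (simp add: Hmul_def x w_def)
    ultimately have "f x = f (a - fl a, b - fl b, w - fl w)" by (metis inv)
    moreover have "(a - fl a, b - fl b, w - fl w) \<in> K"
      using small by (simp add: K_def)
    ultimately show "f x \<in> f ` K" by blast
  qed
  ultimately show ?thesis by (rule bounded_subset)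
qed

lemma Liouville_dbar_constant:
  fixes F :: "complex \<Rightarrow> complex"
  assumes der: "\<And>z. (F has_derivative F' z) (at z)"
    and dbar: "\<And>z. F' z 1 + \<i> * F' z \<i> = c"
    and bnd: "\<And>z. norm (F z) \<le> M"
  shows "c = 0" and "F z = F 0"
proof -
  define G where "G = (\<lambda>z. F z - c / 2 * cnj z)"
  have "(G has_field_derivative (F' z 1 - c / 2)) (at z)" for z
  proof -
    have lin: "linear (F' z)" using der[of z] has_derivative_linear by blast
    have Fi: "F' z \<i> = \<i> * F' z 1 - \<i> * c"
    proof -
      have "\<i> * (F' z 1 + \<i> * F' z \<i>) = \<i> * c" using dbar by simp
      then show ?thesis by (simp add: algebra_simps)
    qed
    \<comment> \<open>A real-linear map of the plane is the sum of a complex-linear and a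
      conjugate-linear part; the latter is \<open>c / 2 * cnj h\<close>, exactly what
      \<open>G\<close> subtracts.\<close>
    have F': "F' z h = F' z 1 * h - c / 2 * h + c / 2 * cnj h" for h
    proof -
      have "F' z (Re h *\<^sub>R 1 + Im h *\<^sub>R \<i>) = Re h *\<^sub>R F' z 1 + Im h *\<^sub>R F' z \<i>"
        by (simp only: linear_add[OF lin] linear_scale[OF lin])
      moreover have "Re h *\<^sub>R 1 + Im h *\<^sub>R \<i> = h" by (simp add: complex_eq_iff)
      ultimately have "F' z h = of_real (Re h) * F' z 1 + of_real (Im h) * (\<i> * F' z 1 - \<i> * c)"
        by (simp add: Fi scaleR_conv_of_real)
      moreover have "of_real (Re h) = (h + cnj h) / 2" "of_real (Im h) = - \<i> * (h - cnj h) / 2"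
        by (simp_all add: complex_eq_iff)
      ultimately have "F' z h = (h + cnj h) / 2 * F' z 1 +
          (- \<i> * (h - cnj h) / 2) * (\<i> * F' z 1 - \<i> * c)" by simp
      also have "(- \<i> * (h - cnj h) / 2) * (\<i> * F' z 1 - \<i> * c) = (h - cnj h) / 2 * (F' z 1 - c)"
      proof -
        have "(- \<i> * d) * (\<i> * a - \<i> * c) = d * (a - c)" for a d
          by (simp add: algebra_simps)
        from this[of "(h - cnj h) / 2" "F' z 1"] show ?thesis by simp
      qed
      also have "(h + cnj h) / 2 * F' z 1 + (h - cnj h) / 2 * (F' z 1 - c) =
          F' z 1 * h - c / 2 * h + c / 2 * cnj h"
        by (simp add: algebra_simps add_divide_distrib diff_divide_distrib)
      finally show ?thesis .
    qed
    have "(G has_derivative (\<lambda>h. F' z h - c / 2 * cnj h)) (at z)"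
      unfolding G_def by (intro derivative_intros der)
    moreover have "(\<lambda>h. F' z h - c / 2 * cnj h) = (*) (F' z 1 - c / 2)"
      by (rule ext, subst F') (simp add: algebra_simps)
    ultimately show ?thesis by (simp add: has_field_derivative_def)
  qed
  then have hol: "G holomorphic_on UNIV"
    by (auto simp: holomorphic_on_def field_differentiable_def)
  have bound: "norm (G z) \<le> (M + norm (c / 2)) * norm z ^ 1" if "1 \<le> norm z" for z
  proof -
    have "norm (G z) \<le> norm (F z) + norm (c / 2 * cnj z)" unfolding G_def by (rule norm_triangle_ineq4)
    also have "\<dots> \<le> M * 1 + norm (c / 2) * norm z" using bnd[of z] by (simp add: norm_mult)
    also have "M * 1 \<le> M * norm z"
      using that bnd[of 0] norm_ge_zero[of "F 0"] by (intro mult_left_mono) linarith+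
    finally show ?thesis by (simp add: algebra_simps)
  qed
  have "G z = G 0 + deriv G 0 * z" for z
    using Liouville_polynomial[OF hol, of 1 "M + norm (c / 2)" 1 z] bound by simp
  then obtain b where G: "G z = G 0 + b * z" for z by blast
  have F: "F z = F 0 + b * z + c / 2 * cnj z" for z
    using G[of z] unfolding G_def by (simp add: diff_eq_eq)
  \<comment> \<open>A real-linear expression that stays bounded on the integer multiples of
    \<open>z\<close> vanishes at \<open>z\<close>; the values at 1 and \<open>\<i>\<close> then give
    b + c / 2 = 0 and b - c / 2 = 0.\<close>
  have lin0: "b * z + c / 2 * cnj z = 0" for z
  proof (rule ccontr)
    assume "b * z + c / 2 * cnj z \<noteq> 0"
    then have pos: "norm (b * z + c / 2 * cnj z) > 0" by simp
    obtain n :: nat where n: "real n * norm (b * z + c / 2 * cnj z) > 2 * M"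
      using reals_Archimedean3[OF pos] by blast
    have "F (of_nat n * z) - F 0 = of_nat n * (b * z + c / 2 * cnj z)"
      by (subst F) (simp add: algebra_simps)
    then have "real n * norm (b * z + c / 2 * cnj z) = norm (F (of_nat n * z) - F 0)"
      by (simp add: norm_mult)
    also have "\<dots> \<le> norm (F (of_nat n * z)) + norm (F 0)" by (rule norm_triangle_ineq4)
    also have "\<dots> \<le> M + M" by (intro add_mono bnd)
    finally show False using n by simp
  qed
  have "b + c / 2 = 0" using lin0[of 1] by simp
  moreover have "\<i> * (b - c / 2) = 0" using lin0[of \<i>] by (simp add: algebra_simps)
  then have "b = c / 2" by simp
  ultimately show "c = 0" by simp
  show "F z = F 0" using F[of z] lin0[of z] by (simp add: add.assoc)
qed

section \<open>The operator dbar on forms of type (p,0)\<close>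

text \<open>For fixed \<open>k\<close> these vectors form the \<open>J\<close>-complex line on which
  the other two \<open>phi j\<close> vanish. The values \<open>1\<close> and \<open>\<i>\<close> of
  \<open>c\<close> give a vector and its image under \<open>J\<close>, so \<open>Vfield\<close> and
  \<open>Vbarfield\<close> are the Wirtinger derivatives dual to \<open>phi k\<close> and
  \<open>phibar k\<close>.\<close>

definition frame_vec :: "nat \<Rightarrow> pt \<Rightarrow> complex \<Rightarrow> pt" where
  "frame_vec k x c = frame x (if k = 1 then c else 0) (if k = 2 then c else 0) (if k = 3 then c else 0)"

definition Vfield :: "nat \<Rightarrow> (pt \<Rightarrow> complex) \<Rightarrow> pt \<Rightarrow> complex" where
  "Vfield k f x = (frechet_derivative f (at x) (frame_vec k x 1) - \<i> * frechet_derivative f (at x) (frame_vec k x \<i>)) / 2"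

definition Vbarfield :: "nat \<Rightarrow> (pt \<Rightarrow> complex) \<Rightarrow> pt \<Rightarrow> complex" where
  "Vbarfield k f x = (frechet_derivative f (at x) (frame_vec k x 1) + \<i> * frechet_derivative f (at x) (frame_vec k x \<i>)) / 2"

lemma frame_decompose:
  "frame x a b c = Re a *\<^sub>R frame x 1 0 0 + Im a *\<^sub>R frame x \<i> 0 0 + Re b *\<^sub>R frame x 0 1 0 +
     Im b *\<^sub>R frame x 0 \<i> 0 + Re c *\<^sub>R frame x 0 0 1 + Im c *\<^sub>R frame x 0 0 \<i>"
  by (simp add: frame_def complex_eq_iff algebra_simps)

text \<open>In each frame direction the real-linear differential splits into a complex-linear and a
  conjugate-linear part; together these are the (1,0)- and (0,1)-parts of the differential of
  \<open>f\<close>.\<close>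

lemma differential_eq_Vfields:
  assumes "f differentiable (at x)"
  shows "frechet_derivative f (at x) v =
    (\<Sum>k\<in>{1,2,3}. Vfield k f x * phi k x v + Vbarfield k f x * phibar k x v)"
proof -
  let ?D = "frechet_derivative f (at x)"
  have lin: "linear ?D" using assms by (rule linear_frechet_derivative)
  have split: "of_real (Re a) * s + of_real (Im a) * t =
      (s - \<i> * t) / 2 * a + (s + \<i> * t) / 2 * cnj a" for a s t
    by (simp add: complex_eq_iff algebra_simps add_divide_distrib diff_divide_distrib)
  have "?D v = ?D (frame x (phi 1 x v) (phi 2 x v) (phi 3 x v))" by (simp only: frame_phi)
  also have "\<dots> = (of_real (Re (phi 1 x v)) * ?D (frame x 1 0 0) + of_real (Im (phi 1 x v)) * ?D (frame x \<i> 0 0))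
      + (of_real (Re (phi 2 x v)) * ?D (frame x 0 1 0) + of_real (Im (phi 2 x v)) * ?D (frame x 0 \<i> 0))
      + (of_real (Re (phi 3 x v)) * ?D (frame x 0 0 1) + of_real (Im (phi 3 x v)) * ?D (frame x 0 0 \<i>))"
    by (subst frame_decompose)
       (simp only: linear_add[OF lin] linear_scale[OF lin] scaleR_conv_of_real add.assoc)
  finally show ?thesis
    unfolding split by (simp add: Vfield_def Vbarfield_def frame_vec_def phibar_def algebra_simps)
qed

text \<open>\<open>dphi j u v\<close> is the derivative of \<open>phi j\<close> in direction \<open>u\<close>, evaluated at \<open>v\<close>;
  its antisymmetrisation is the structure equation for \<open>phi j\<close>.\<close>

lemma dphi_eq:
  "dphi 1 u v = - (phi 1 x u + phibar 1 x u) * (phi 3 x v - phibar 3 x v) / 4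
     - \<i> * (phi 2 x u + phibar 2 x u) * (phi 3 x v + phibar 3 x v) / 4"
  "dphi 2 u v = - \<i> * (phi 1 x u + phibar 1 x u) * (phi 3 x v + phibar 3 x v) / 4
     + (phi 2 x u + phibar 2 x u) * (phi 3 x v - phibar 3 x v) / 4"
  "dphi 3 u v = 0"
  by (simp_all add: dphi_def phibar_def phi_def e1_def e2_def e3_def e4_def e5_def e6_def complex_eq_iff
      algebra_simps)

definition dbar_phi :: "nat \<Rightarrow> pt \<Rightarrow> (pt list \<Rightarrow> complex) \<Rightarrow> pt list \<Rightarrow> complex" where
  "dbar_phi j x \<eta> vs =
    (let A = (\<lambda>i k. cwedge (phi i x) (cwedge (phibar k x) \<eta>) vs) in
     if j = 1 then (A 1 3 + A 3 1) / 4 - \<i> / 4 * (A 2 3 - A 3 2)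
     else if j = 2 then - \<i> / 4 * (A 1 3 - A 3 1) - (A 2 3 + A 3 2) / 4
     else 0)"

text \<open>The \<open>(2,0)\<close> and \<open>(0,2)\<close> parts of the differential of \<open>phi j\<close>, wedged with \<open>\<eta>\<close>;
  \<open>dbar_phi\<close> is the \<open>(1,1)\<close> part.\<close>

definition dphi_rest :: "nat \<Rightarrow> pt \<Rightarrow> (pt list \<Rightarrow> complex) \<Rightarrow> pt list \<Rightarrow> complex" where
  "dphi_rest j x \<eta> vs =
    (let E = (\<lambda>i k. cwedge (phi i x) (cwedge (phi k x) \<eta>) vs);
         F = (\<lambda>i k. cwedge (phibar i x) (cwedge (phibar k x) \<eta>) vs) in
     if j = 1 then - (E 1 3 - F 1 3) / 4 - \<i> / 4 * (E 2 3 + F 2 3)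
     else if j = 2 then - \<i> / 4 * (E 1 3 + F 1 3) + (E 2 3 - F 2 3) / 4
     else 0)"

lemma dsum_add: "dsum (\<lambda>u v l. T u v l + T' u v l) vs = dsum T vs + dsum T' vs"
  and dsum_scale: "dsum (\<lambda>u v l. c * T u v l) vs = c * dsum T vs"
  by (simp_all only: dsum_def Let_def distrib_left right_diff_distrib sum.distrib sum_subtractf
      mult.left_commute[of _ c] sum_distrib_left[symmetric])

text \<open>\<open>dsum\<close> antisymmetrises \<open>dphi j\<close>, so the left side is the
  differential of \<open>phi j\<close> wedged with \<open>\<eta>\<close>. For \<open>j\<close> = 1,
  2 the structure equation gives eight products of covectors, each a double exterior multiplication;
  those with the barred factor before an unbarred one are swapped.\<close>

lemma dsum_dphi:
  assumes "j \<in> {1,2,3}"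
  shows "dsum (\<lambda>u v l. dphi j u v * \<eta> l) vs = dbar_phi j x \<eta> vs + dphi_rest j x \<eta> vs"
proof -
  let ?S = "\<lambda>a b. dsum (\<lambda>u v l. a u * b v * \<eta> l) vs"
  have S: "?S a b = cwedge a (cwedge b \<eta>) vs" for a b
    by (simp only: cwedge_cwedge)
  have 1: "cwedge (phibar i x) (cwedge (phi k x) \<eta>) vs = - cwedge (phi k x) (cwedge (phibar i x) \<eta>) vs" for i k
    by (simp add: cwedge_anticommute[of "phibar i x"])
  consider "j = 1" | "j = 2" | "j = 3" using assms by blast
  then show ?thesis
  proof cases
    case j: 1
    have eq: "(\<lambda>u v l. dphi j u v * \<eta> l) = (\<lambda>u v l.
        - 1 / 4 * (phi 1 x u * phi 3 x v * \<eta> l) + 1 / 4 * (phi 1 x u * phibar 3 x v * \<eta> l)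
        + - 1 / 4 * (phibar 1 x u * phi 3 x v * \<eta> l) + 1 / 4 * (phibar 1 x u * phibar 3 x v * \<eta> l)
        + - \<i> / 4 * (phi 2 x u * phi 3 x v * \<eta> l) + - \<i> / 4 * (phi 2 x u * phibar 3 x v * \<eta> l)
        + - \<i> / 4 * (phibar 2 x u * phi 3 x v * \<eta> l) + - \<i> / 4 * (phibar 2 x u * phibar 3 x v * \<eta> l))"
      unfolding j dphi_eq(1)[of _ _ x] by (intro ext) (simp add: field_simps)
    show ?thesis
      unfolding eq dsum_add dsum_scale S 1
      by (simp add: j dbar_phi_def dphi_rest_def algebra_simps add_divide_distrib diff_divide_distrib)
  next
    case j: 2
    have eq: "(\<lambda>u v l. dphi j u v * \<eta> l) = (\<lambda>u v l.
        - \<i> / 4 * (phi 1 x u * phi 3 x v * \<eta> l) + - \<i> / 4 * (phi 1 x u * phibar 3 x v * \<eta> l)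
        + - \<i> / 4 * (phibar 1 x u * phi 3 x v * \<eta> l) + - \<i> / 4 * (phibar 1 x u * phibar 3 x v * \<eta> l)
        + 1 / 4 * (phi 2 x u * phi 3 x v * \<eta> l) + - 1 / 4 * (phi 2 x u * phibar 3 x v * \<eta> l)
        + 1 / 4 * (phibar 2 x u * phi 3 x v * \<eta> l) + - 1 / 4 * (phibar 2 x u * phibar 3 x v * \<eta> l))"
      unfolding j dphi_eq(2)[of _ _ x] by (intro ext) (simp add: field_simps)
    show ?thesis
      unfolding eq dsum_add dsum_scale S 1
      by (simp add: j dbar_phi_def dphi_rest_def algebra_simps add_divide_distrib diff_divide_distrib)
  next
    case j: 3
    then show ?thesis by (simp add: dphi_eq dbar_phi_def dphi_rest_def dsum_def)
  qed
qed

lemma Lam_intros: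
  "(\<lambda>vs. 0) \<in> Lam p q x"
  "\<eta> \<in> Lam p q x \<Longrightarrow> \<theta> \<in> Lam p q x \<Longrightarrow> (\<lambda>vs. \<eta> vs + \<theta> vs) \<in> Lam p q x"
  "\<eta> \<in> Lam p q x \<Longrightarrow> \<theta> \<in> Lam p q x \<Longrightarrow> (\<lambda>vs. \<eta> vs - \<theta> vs) \<in> Lam p q x"
  "\<eta> \<in> Lam p q x \<Longrightarrow> (\<lambda>vs. - \<eta> vs) \<in> Lam p q x"
  "\<eta> \<in> Lam p q x \<Longrightarrow> (\<lambda>vs. c * \<eta> vs) \<in> Lam p q x"
  "\<eta> \<in> Lam p q x \<Longrightarrow> (\<lambda>vs. \<eta> vs / c) \<in> Lam p q x"
  unfolding Lam_def by (rule lin_span_c_intros; assumption)+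

lemma Lam_compl_intros:
  "(\<lambda>vs. 0) \<in> Lam_compl p q x"
  "\<eta> \<in> Lam_compl p q x \<Longrightarrow> \<theta> \<in> Lam_compl p q x \<Longrightarrow> (\<lambda>vs. \<eta> vs + \<theta> vs) \<in> Lam_compl p q x"
  "\<eta> \<in> Lam_compl p q x \<Longrightarrow> \<theta> \<in> Lam_compl p q x \<Longrightarrow> (\<lambda>vs. \<eta> vs - \<theta> vs) \<in> Lam_compl p q x"
  "\<eta> \<in> Lam_compl p q x \<Longrightarrow> (\<lambda>vs. - \<eta> vs) \<in> Lam_compl p q x"
  "\<eta> \<in> Lam_compl p q x \<Longrightarrow> (\<lambda>vs. c * \<eta> vs) \<in> Lam_compl p q x"
  "\<eta> \<in> Lam_compl p q x \<Longrightarrow> (\<lambda>vs. \<eta> vs / c) \<in> Lam_compl p q x"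
  unfolding Lam_compl_def by (rule lin_span_c_intros; assumption)+

lemma dbar_phi_Lam:
  assumes "\<eta> \<in> Lam p q x"
  shows "dbar_phi j x \<eta> \<in> Lam (Suc p) (Suc q) x"
proof -
  have A: "(\<lambda>vs. cwedge (phi i x) (cwedge (phibar k x) \<eta>) vs) \<in> Lam (Suc p) (Suc q) x"
    if "i \<in> {1,2,3}" "k \<in> {1,2,3}" for i k
    using cwedge_phi_Lam[OF cwedge_phibar_Lam[OF assms]] that by simp
  show ?thesis
    unfolding dbar_phi_def[abs_def] Let_def
    by (cases "j = 1"; cases "j = 2"; simp only: if_True if_False simp_thms)
       (intro Lam_intros A; simp)+
qed

lemma dphi_rest_Lam_compl:
  assumes "\<eta> \<in> Lam p q x"
  shows "dphi_rest j x \<eta> \<in> Lam_compl (Suc p) (Suc q) x"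
proof -
  have E: "(\<lambda>vs. cwedge (phi i x) (cwedge (phi k x) \<eta>) vs) \<in> Lam_compl (Suc p) (Suc q) x"
    if "i \<in> {1,2,3}" "k \<in> {1,2,3}" for i k
    by (rule Lam_subset_Lam_compl[of "Suc (Suc p)" q])
       (use cwedge_phi_Lam[OF cwedge_phi_Lam[OF assms]] that in simp_all)
  have F: "(\<lambda>vs. cwedge (phibar i x) (cwedge (phibar k x) \<eta>) vs) \<in> Lam_compl (Suc p) (Suc q) x"
    if "i \<in> {1,2,3}" "k \<in> {1,2,3}" for i k
    by (rule Lam_subset_Lam_compl[of p "Suc (Suc q)"])
       (use cwedge_phibar_Lam[OF cwedge_phibar_Lam[OF assms]] that in simp_all)
  have eq: "- (a - b) / 4 = (b - a) / (4::complex)" for a b by simp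
  show ?thesis
    unfolding dphi_rest_def[abs_def] Let_def eq
    by (cases "j = 1"; cases "j = 2"; simp only: if_True if_False simp_thms)
       (intro Lam_compl_intros E F; simp)+
qed

text \<open>A certificate that \<open>\<theta>\<close> is the value of \<open>dbar\<close>. It
  carries the type, the differentiability and the splitting of \<open>ext_d \<omega>\<close> that
  the product rules need, so the definite description is met only once, in
  \<open>has_dbar_imp_dbar\<close>.\<close>

definition has_dbar :: "nat \<Rightarrow> cform \<Rightarrow> pt \<Rightarrow> (pt list \<Rightarrow> complex) \<Rightarrow> bool" where
  "has_dbar p \<omega> x \<theta> \<longleftrightarrow> (\<forall>l. (\<lambda>y. \<omega> y l) differentiable (at x)) \<and> \<omega> x \<in> Lam p 0 x \<and>
     \<theta> \<in> Lam p 1 x \<and> (\<lambda>vs. ext_d \<omega> x vs - \<theta> vs) \<in> Lam_compl p 1 x"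

lemma has_dbar_imp_dbar: "has_dbar p \<omega> x \<theta> \<Longrightarrow> dbar p 0 \<omega> x = \<theta>"
  unfolding has_dbar_def dbar_def by (simp add: bidegree_comp_eqI)

text \<open>The Leibniz rule. Differentiating \<open>phi j\<close> gives the first term.
  Differentiating \<open>\<eta>\<close> gives a double sum in which the direction of differentiation
  is removed first; \<open>dsum_swap\<close> turns it into minus the exterior product of
  \<open>phi j\<close> with the differential of \<open>\<eta>\<close>.\<close>

lemma ext_d_cwedge_phi:
  assumes "\<And>l. (\<lambda>y. \<eta> y l) differentiable (at x)"
  shows "ext_d (\<lambda>y. cwedge (phi j y) (\<eta> y)) x vs =
    dsum (\<lambda>u v l. dphi j u v * \<eta> x l) vs - cwedge (phi j x) (ext_d \<eta> x) vs"
proof -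
  let ?D = "\<lambda>l. frechet_derivative (\<lambda>y. \<eta> y l) (at x)"
  have der: "((\<lambda>y. \<eta> y l) has_derivative ?D l) (at x)" for l
    using assms by (simp add: frechet_derivative_works)
  have *: "frechet_derivative (\<lambda>y. cwedge (phi j y) (\<eta> y) l) (at x) u =
     (\<Sum>k<length l. (-1) ^ k * (dphi j u (l ! k) * \<eta> x (take k l @ drop (Suc k) l) +
        phi j x (l ! k) * ?D (take k l @ drop (Suc k) l) u))" for l u
  proof -
    have "((\<lambda>y. cwedge (phi j y) (\<eta> y) l) has_derivative (\<lambda>u.
       \<Sum>k<length l. (-1) ^ k * (phi j x (l ! k) * ?D (take k l @ drop (Suc k) l) u +
         dphi j u (l ! k) * \<eta> x (take k l @ drop (Suc k) l)))) (at x)"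
      unfolding cwedge_def mult.assoc
      by (intro has_derivative_sum has_derivative_mult_right has_derivative_mult phi_has_derivative der)
    from fun_cong[OF frechet_derivative_at[OF this], of u] show ?thesis by (simp add: add.commute)
  qed
  have "ext_d (\<lambda>y. cwedge (phi j y) (\<eta> y)) x vs =
     dsum (\<lambda>u v l. dphi j u v * \<eta> x l + phi j x v * ?D l u) vs"
    unfolding ext_d_def * dsum_def Let_def
  proof (intro sum.cong refl)
    fix i assume i: "i \<in> {..<length vs}"
    then have len: "length (take i vs @ drop (Suc i) vs) = length vs - 1" by auto
    show "(-1) ^ i * (\<Sum>k<length (take i vs @ drop (Suc i) vs). (-1) ^ k *
          (dphi j (vs ! i) ((take i vs @ drop (Suc i) vs) ! k) * \<eta> x (take k (take i vs @ drop (Suc i) vs) @ drop (Suc k) (take i vs @ drop (Suc i) vs)) +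
           phi j x ((take i vs @ drop (Suc i) vs) ! k) *
           ?D (take k (take i vs @ drop (Suc i) vs) @ drop (Suc k) (take i vs @ drop (Suc i) vs)) (vs ! i))) =
      (\<Sum>k<length vs - 1. (-1) ^ (i + k) *
          (dphi j (vs ! i) ((take i vs @ drop (Suc i) vs) ! k) * \<eta> x (take k (take i vs @ drop (Suc i) vs) @ drop (Suc k) (take i vs @ drop (Suc i) vs)) +
           phi j x ((take i vs @ drop (Suc i) vs) ! k) *
           ?D (take k (take i vs @ drop (Suc i) vs) @ drop (Suc k) (take i vs @ drop (Suc i) vs)) (vs ! i)))"
      unfolding len sum_distrib_left power_add mult.assoc ..
  qed
  also have "\<dots> = dsum (\<lambda>u v l. dphi j u v * \<eta> x l) vs + dsum (\<lambda>u v l. phi j x v * ?D l u) vs"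
    by (rule dsum_add)
  also have "dsum (\<lambda>u v l. phi j x v * ?D l u) vs = - dsum (\<lambda>u v l. phi j x u * ?D l v) vs"
    by (rule dsum_swap)
  also have "dsum (\<lambda>u v l. phi j x u * ?D l v) vs = cwedge (phi j x) (ext_d \<eta> x) vs"
    unfolding cwedge_def dsum_def Let_def
  proof (intro sum.cong refl)
    fix i assume i: "i \<in> {..<length vs}"
    then have len: "length (take i vs @ drop (Suc i) vs) = length vs - 1" by auto
    show "(\<Sum>k<length vs - 1. (-1) ^ (i + k) * (phi j x (vs ! i) *
         ?D (take k (take i vs @ drop (Suc i) vs) @ drop (Suc k) (take i vs @ drop (Suc i) vs)) ((take i vs @ drop (Suc i) vs) ! k))) =
       (-1) ^ i * phi j x (vs ! i) * ext_d \<eta> x (take i vs @ drop (Suc i) vs)"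
      unfolding ext_d_def len sum_distrib_left power_add
      by (intro sum.cong refl) (simp only: ac_simps)
  qed
  finally show ?thesis by simp
qed

text \<open>The (p+1,1)-part of the Leibniz rule: \<open>dphi_rest\<close> and the product of
  \<open>phi j\<close> with the remainder of \<open>ext_d \<eta>\<close> contain only other
  bidegrees.\<close>

lemma has_dbar_cwedge_phi:
  assumes "has_dbar p \<eta> x \<theta>" "j \<in> {1,2,3}"
  shows "has_dbar (Suc p) (\<lambda>y. cwedge (phi j y) (\<eta> y)) x
    (\<lambda>vs. dbar_phi j x (\<eta> x) vs - cwedge (phi j x) \<theta> vs)"
  unfolding has_dbar_def
proof (intro conjI allI)
  have \<eta>: "\<And>l. (\<lambda>y. \<eta> y l) differentiable (at x)" "\<eta> x \<in> Lam p 0 x" "\<theta> \<in> Lam p 1 x"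
    "(\<lambda>vs. ext_d \<eta> x vs - \<theta> vs) \<in> Lam_compl p 1 x"
    using assms(1) by (auto simp: has_dbar_def)
  have phi: "(\<lambda>y. phi j y v) differentiable (at x)" for v
    using phi_has_derivative[of j v x] unfolding differentiable_def by blast
  show "(\<lambda>y. cwedge (phi j y) (\<eta> y) l) differentiable (at x)" for l
    unfolding cwedge_def by (intro differentiable_sum) (auto intro!: differentiable_mult phi \<eta>(1))
  show "cwedge (phi j x) (\<eta> x) \<in> Lam (Suc p) 0 x"
    using cwedge_phi_Lam \<eta> assms(2) by blast
  show "(\<lambda>vs. dbar_phi j x (\<eta> x) vs - cwedge (phi j x) \<theta> vs) \<in> Lam (Suc p) 1 x"
    using dbar_phi_Lam[OF \<eta>(2), of j] cwedge_phi_Lam[OF \<eta>(3) assms(2)] by (intro Lam_intros) simp_all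
  have "(\<lambda>vs. dphi_rest j x (\<eta> x) vs - cwedge (phi j x) (\<lambda>vs. ext_d \<eta> x vs - \<theta> vs) vs) \<in> Lam_compl (Suc p) 1 x"
    using dphi_rest_Lam_compl[OF \<eta>(2), of j] cwedge_phi_Lam_compl[OF \<eta>(4) assms(2)]
    by (intro Lam_compl_intros) simp_all
  moreover have "ext_d (\<lambda>y. cwedge (phi j y) (\<eta> y)) x vs - (dbar_phi j x (\<eta> x) vs - cwedge (phi j x) \<theta> vs) =
      dphi_rest j x (\<eta> x) vs - cwedge (phi j x) (\<lambda>vs. ext_d \<eta> x vs - \<theta> vs) vs" for vs
    unfolding ext_d_cwedge_phi[OF \<eta>(1)] dsum_dphi[OF assms(2), of _ _ x] cwedge_diff by simp
  ultimately show "(\<lambda>vs. ext_d (\<lambda>y. cwedge (phi j y) (\<eta> y)) x vs -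
      (dbar_phi j x (\<eta> x) vs - cwedge (phi j x) \<theta> vs)) \<in> Lam_compl (Suc p) 1 x"
    by (simp only:)
qed

lemma has_dbar_wedge_Nil: "has_dbar 0 (\<lambda>y. wedge []) x (\<lambda>vs. 0)"
proof -
  have "wedge [] \<in> gens 0 0 x" by (auto simp: gens_def)
  then show ?thesis
    unfolding has_dbar_def
    by (simp add: ext_d_def frechet_derivative_const lin_span_c_base Lam_def Lam_intros(1)[unfolded Lam_def]
        Lam_compl_intros(1))
qed

lemma has_dbar_add:
  assumes "has_dbar p \<eta> x \<theta>" "has_dbar p \<eta>' x \<theta>'"
  shows "has_dbar p (\<lambda>y vs. \<eta> y vs + \<eta>' y vs) x (\<lambda>vs. \<theta> vs + \<theta>' vs)"
proof -
  have "((\<lambda>y. \<eta> y l + \<eta>' y l) has_derivative (\<lambda>u. frechet_derivative (\<lambda>y. \<eta> y l) (at x) u +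
      frechet_derivative (\<lambda>y. \<eta>' y l) (at x) u)) (at x)" for l
    using assms by (intro has_derivative_add) (auto simp: has_dbar_def frechet_derivative_works)
  note der = this frechet_derivative_at[OF this, symmetric]
  have "ext_d (\<lambda>y vs. \<eta> y vs + \<eta>' y vs) x vs = ext_d \<eta> x vs + ext_d \<eta>' x vs" for vs
    unfolding ext_d_def der(2) by (simp add: distrib_left sum.distrib)
  then have "(\<lambda>vs. ext_d (\<lambda>y vs. \<eta> y vs + \<eta>' y vs) x vs - (\<theta> vs + \<theta>' vs)) =
      (\<lambda>vs. (ext_d \<eta> x vs - \<theta> vs) + (ext_d \<eta>' x vs - \<theta>' vs))" by auto
  moreover have "\<dots> \<in> Lam_compl p 1 x"
    using assms unfolding has_dbar_def by (intro Lam_compl_intros(2)) blast+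
  ultimately show ?thesis
    using assms der(1) unfolding has_dbar_def by (auto intro: Lam_intros simp: differentiable_def)
qed

text \<open>Only the (0,1)-part of the differential of \<open>f\<close> leads to type (p,1); the
  \<open>Vfield\<close> terms have type (p+1,0) and fall into the complement.\<close>

lemma has_dbar_scale:
  assumes "has_dbar p \<eta> x \<theta>" "f differentiable (at x)"
  shows "has_dbar p (\<lambda>y vs. f y * \<eta> y vs) x
    (\<lambda>vs. (\<Sum>k\<in>{1,2,3}. Vbarfield k f x * cwedge (phibar k x) (\<eta> x) vs) + f x * \<theta> vs)"
proof -
  have \<eta>: "\<And>l. (\<lambda>y. \<eta> y l) differentiable (at x)" "\<eta> x \<in> Lam p 0 x" "\<theta> \<in> Lam p 1 x"
    "(\<lambda>vs. ext_d \<eta> x vs - \<theta> vs) \<in> Lam_compl p 1 x"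
    using assms(1) by (auto simp: has_dbar_def)
  have "((\<lambda>y. f y * \<eta> y l) has_derivative (\<lambda>u. f x * frechet_derivative (\<lambda>y. \<eta> y l) (at x) u +
      frechet_derivative f (at x) u * \<eta> x l)) (at x)" for l
    using \<eta>(1) assms(2) by (intro has_derivative_mult) (auto simp: frechet_derivative_works)
  note der = this frechet_derivative_at[OF this, symmetric]
  have "ext_d (\<lambda>y vs. f y * \<eta> y vs) x vs =
      cwedge (frechet_derivative f (at x)) (\<eta> x) vs + f x * ext_d \<eta> x vs" for vs
    unfolding ext_d_def der(2) cwedge_def
    by (simp add: distrib_left sum.distrib sum_distrib_left ac_simps)
  moreover have "cwedge (frechet_derivative f (at x)) (\<eta> x) vs =
      (\<Sum>k\<in>{1,2,3}. Vfield k f x * cwedge (phi k x) (\<eta> x) vs) +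
      (\<Sum>k\<in>{1,2,3}. Vbarfield k f x * cwedge (phibar k x) (\<eta> x) vs)" for vs
    unfolding cwedge_def differential_eq_Vfields[OF assms(2)]
    by (simp add: distrib_left distrib_right sum.distrib sum_distrib_left ac_simps)
  ultimately have "ext_d (\<lambda>y vs. f y * \<eta> y vs) x vs - ((\<Sum>k\<in>{1,2,3}. Vbarfield k f x * cwedge (phibar k x) (\<eta> x) vs) + f x * \<theta> vs) =
    (\<Sum>k\<in>{1,2,3}. Vfield k f x * cwedge (phi k x) (\<eta> x) vs) + f x * (ext_d \<eta> x vs - \<theta> vs)" for vs
    by (simp add: algebra_simps)
  moreover have "(\<lambda>vs. cwedge (phi k x) (\<eta> x) vs) \<in> Lam_compl p 1 x" if "k \<in> {1,2,3}" for k
    by (rule Lam_subset_Lam_compl[of "Suc p" 0]) (use cwedge_phi_Lam[OF \<eta>(2)] that in simp_all)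
  then have "(\<lambda>vs. (\<Sum>k\<in>{1,2,3}. Vfield k f x * cwedge (phi k x) (\<eta> x) vs) + f x * (ext_d \<eta> x vs - \<theta> vs)) \<in> Lam_compl p 1 x"
    using \<eta>(4) by (simp add: Lam_compl_intros(2) Lam_compl_intros(5))
  moreover have "(\<lambda>vs. cwedge (phibar k x) (\<eta> x) vs) \<in> Lam p 1 x" if "k \<in> {1,2,3}" for k
    using cwedge_phibar_Lam[OF \<eta>(2)] that by simp
  then have "(\<lambda>vs. (\<Sum>k\<in>{1,2,3}. Vbarfield k f x * cwedge (phibar k x) (\<eta> x) vs) + f x * \<theta> vs) \<in> Lam p 1 x"
    using \<eta>(3) by (simp add: Lam_intros(2) Lam_intros(5))
  ultimately show ?thesis
    using \<eta> der(1) unfolding has_dbar_def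
    by (auto intro: Lam_intros simp: differentiable_def simp del: sum.insert)
qed

section \<open>Coefficients with respect to the coframe\<close>

text \<open>Contraction with the complex tangent vector \<open>(u + \<epsilon> * w) / 2\<close>.\<close>

definition contract :: "complex \<Rightarrow> pt \<Rightarrow> pt \<Rightarrow> (pt list \<Rightarrow> complex) \<Rightarrow> pt list \<Rightarrow> complex" where
  "contract \<epsilon> u w \<eta> l = (\<eta> (u # l) + \<epsilon> * \<eta> (w # l)) / 2"

text \<open>Antiderivation rule for complex contractions. Since \<open>contract_V\<close> and
  \<open>contract_Vbar\<close> are dual to the coframe, they strip off one factor at a time and
  isolate single coefficients.\<close>

lemma contract_cwedge:
  "contract \<epsilon> u w (cwedge a \<eta>) = (\<lambda>l. (a u + \<epsilon> * a w) / 2 * \<eta> l - cwedge a (contract \<epsilon> u w \<eta>) l)"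
proof
  fix l
  have "cwedge a (contract \<epsilon> u w \<eta>) l =
      (cwedge a (\<lambda>l. \<eta> (u # l)) l + \<epsilon> * cwedge a (\<lambda>l. \<eta> (w # l)) l) / 2"
    unfolding contract_def[abs_def] by (simp only: cwedge_linear)
  then show "contract \<epsilon> u w (cwedge a \<eta>) l = (a u + \<epsilon> * a w) / 2 * \<eta> l - cwedge a (contract \<epsilon> u w \<eta>) l"
    by (simp add: contract_def cwedge_Cons algebra_simps add_divide_distrib diff_divide_distrib)
qed

definition contract_V :: "nat \<Rightarrow> pt \<Rightarrow> (pt list \<Rightarrow> complex) \<Rightarrow> pt list \<Rightarrow> complex" where
  "contract_V k x = contract (- \<i>) (frame_vec k x 1) (frame_vec k x \<i>)"

definition contract_Vbar :: "nat \<Rightarrow> pt \<Rightarrow> (pt list \<Rightarrow> complex) \<Rightarrow> pt list \<Rightarrow> complex" where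
  "contract_Vbar k x = contract \<i> (frame_vec k x 1) (frame_vec k x \<i>)"

lemma phi_frame_vec:
  "j \<in> {1,2,3} \<Longrightarrow> k \<in> {1,2,3} \<Longrightarrow> phi j x (frame_vec k x c) = (if j = k then c else 0)"
  by (auto simp: frame_vec_def phi_frame)

lemma contract_V_cwedge_phi:
  assumes "j \<in> {1,2,3}" "k \<in> {1,2,3}"
  shows "contract_V k x (cwedge (phi j x) \<eta>) =
    (\<lambda>l. (if j = k then \<eta> l else 0) - cwedge (phi j x) (contract_V k x \<eta>) l)"
  unfolding contract_V_def contract_cwedge by (simp add: phi_frame_vec[OF assms])

lemma contract_Vbar_cwedge_phibar:
  assumes "j \<in> {1,2,3}" "k \<in> {1,2,3}"
  shows "contract_Vbar k x (cwedge (phibar j x) \<eta>) =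
    (\<lambda>l. (if j = k then \<eta> l else 0) - cwedge (phibar j x) (contract_Vbar k x \<eta>) l)"
  unfolding contract_Vbar_def contract_cwedge by (simp add: phibar_def phi_frame_vec[OF assms])

lemma contract_V_cwedge_phibar:
  assumes "j \<in> {1,2,3}" "k \<in> {1,2,3}"
  shows "contract_V k x (cwedge (phibar j x) \<eta>) = (\<lambda>l. - cwedge (phibar j x) (contract_V k x \<eta>) l)"
  unfolding contract_V_def contract_cwedge by (simp add: phibar_def phi_frame_vec[OF assms])

lemma contract_V_linear:
  "contract_V k x (\<lambda>vs. 0) = (\<lambda>l. 0)"
  "contract_V k x (\<lambda>vs. - \<eta> vs) = (\<lambda>l. - contract_V k x \<eta> l)"
  "contract_V k x (\<lambda>vs. \<eta> vs + \<theta> vs) = (\<lambda>l. contract_V k x \<eta> l + contract_V k x \<theta> l)"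
  "contract_V k x (\<lambda>vs. \<eta> vs - \<theta> vs) = (\<lambda>l. contract_V k x \<eta> l - contract_V k x \<theta> l)"
  "contract_V k x (\<lambda>vs. c * \<eta> vs) = (\<lambda>l. c * contract_V k x \<eta> l)"
  by (simp_all add: contract_V_def contract_def[abs_def] algebra_simps add_divide_distrib diff_divide_distrib)

lemma contract_Vbar_linear:
  "contract_Vbar k x (\<lambda>vs. 0) = (\<lambda>l. 0)"
  "contract_Vbar k x (\<lambda>vs. - \<eta> vs) = (\<lambda>l. - contract_Vbar k x \<eta> l)"
  "contract_Vbar k x (\<lambda>vs. \<eta> vs + \<theta> vs) = (\<lambda>l. contract_Vbar k x \<eta> l + contract_Vbar k x \<theta> l)"
  "contract_Vbar k x (\<lambda>vs. \<eta> vs - \<theta> vs) = (\<lambda>l. contract_Vbar k x \<eta> l - contract_Vbar k x \<theta> l)"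
  "contract_Vbar k x (\<lambda>vs. c * \<eta> vs) = (\<lambda>l. c * contract_Vbar k x \<eta> l)"
  by (simp_all add: contract_Vbar_def contract_def[abs_def] algebra_simps add_divide_distrib diff_divide_distrib)

lemma contract_wedge_Nil:
  "contract_V k x (wedge []) = (\<lambda>l. 0)" "contract_Vbar k x (wedge []) = (\<lambda>l. 0)"
  by (simp_all add: contract_V_def contract_Vbar_def contract_def[abs_def] wedge_Nil)

lemmas contract_simps = contract_V_cwedge_phi contract_V_cwedge_phibar contract_Vbar_cwedge_phibar
  contract_V_linear contract_Vbar_linear contract_wedge_Nil wedge_Cons cwedge_zero[abs_def] wedge_Nil

section \<open>Independence of the wedge monomials of type (p,1)\<close>

lemma wedge_11_independent:
  assumes "(\<lambda>vs. c11 * wedge [phi 1 x, phibar 1 x] vs + c12 * wedge [phi 1 x, phibar 2 x] vs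
      + c13 * wedge [phi 1 x, phibar 3 x] vs + c21 * wedge [phi 2 x, phibar 1 x] vs
      + c22 * wedge [phi 2 x, phibar 2 x] vs + c23 * wedge [phi 2 x, phibar 3 x] vs
      + c31 * wedge [phi 3 x, phibar 1 x] vs + c32 * wedge [phi 3 x, phibar 2 x] vs
      + c33 * wedge [phi 3 x, phibar 3 x] vs) = (\<lambda>vs. 0)" (is "?\<theta> = _")
  shows "c11 = 0 \<and> c12 = 0 \<and> c13 = 0 \<and> c21 = 0 \<and> c22 = 0 \<and> c23 = 0 \<and> c31 = 0 \<and> c32 = 0 \<and> c33 = 0"
proof -
  have *: "contract_Vbar k x (contract_V j x ?\<theta>) [] = 0" for j k
    unfolding assms by (simp add: contract_simps)
  show ?thesis
    using *[of 1 1] *[of 2 1] *[of 3 1] *[of 1 2] *[of 2 2] *[of 3 2] *[of 1 3] *[of 2 3] *[of 3 3]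
    by (simp add: contract_simps)
qed

lemma wedge_21_independent:
  assumes "(\<lambda>vs. c11 * wedge [phi 1 x, phi 2 x, phibar 1 x] vs + c12 * wedge [phi 1 x, phi 2 x, phibar 2 x] vs
      + c13 * wedge [phi 1 x, phi 2 x, phibar 3 x] vs + c21 * wedge [phi 1 x, phi 3 x, phibar 1 x] vs
      + c22 * wedge [phi 1 x, phi 3 x, phibar 2 x] vs + c23 * wedge [phi 1 x, phi 3 x, phibar 3 x] vs
      + c31 * wedge [phi 2 x, phi 3 x, phibar 1 x] vs + c32 * wedge [phi 2 x, phi 3 x, phibar 2 x] vs
      + c33 * wedge [phi 2 x, phi 3 x, phibar 3 x] vs) = (\<lambda>vs. 0)" (is "?\<theta> = _")
  shows "c11 = 0 \<and> c12 = 0 \<and> c13 = 0 \<and> c21 = 0 \<and> c22 = 0 \<and> c23 = 0 \<and> c31 = 0 \<and> c32 = 0 \<and> c33 = 0"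
proof -
  have *: "contract_Vbar k x (contract_V j x (contract_V i x ?\<theta>)) [] = 0" for i j k
    unfolding assms by (simp add: contract_simps)
  show ?thesis
    using *[of 1 1 2] *[of 2 1 2] *[of 3 1 2] *[of 1 1 3] *[of 2 1 3] *[of 3 1 3]
      *[of 1 2 3] *[of 2 2 3] *[of 3 2 3]
    by (simp add: contract_simps)
qed

lemma wedge_31_independent:
  assumes "(\<lambda>vs. c1 * wedge [phi 1 x, phi 2 x, phi 3 x, phibar 1 x] vs
      + c2 * wedge [phi 1 x, phi 2 x, phi 3 x, phibar 2 x] vs
      + c3 * wedge [phi 1 x, phi 2 x, phi 3 x, phibar 3 x] vs) = (\<lambda>vs. 0)" (is "?\<theta> = _")
  shows "c1 = 0 \<and> c2 = 0 \<and> c3 = 0"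
proof -
  have *: "contract_Vbar k x (contract_V 3 x (contract_V 2 x (contract_V 1 x ?\<theta>))) [] = 0" for k
    unfolding assms by (simp add: contract_simps)
  show ?thesis
    using *[of 1] *[of 2] *[of 3] by (simp add: contract_simps)
qed

text \<open>Sorts products: unbarred factors first and with increasing indices. Barred factors need
  no order among themselves, as at most one occurs. \<open>Suc 0\<close> is the form in which
  simplification leaves the index 1.\<close>

lemmas cwedge_normalize = cwedge_anticommute[of "phibar k x" "phi j x" for k j x]
  cwedge_anticommute[of "phi 2 x" "phi (Suc 0) x" for x] cwedge_anticommute[of "phi 3 x" "phi (Suc 0) x" for x]
  cwedge_anticommute[of "phi 3 x" "phi 2 x" for x] cwedge_square cwedge_linear cwedge_linear[abs_def]

text \<open>Forms of type (p,0) are complex-multilinear, so their values on the real vectors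
  \<open>frame_vec k x 1\<close> are the coefficients. For barred factors this would fail, because
  \<open>phibar k\<close> and \<open>phi k\<close> agree on these vectors; hence the complex
  contractions used for type (p,1).\<close>

lemma Lam_1_0_expand:
  assumes "\<eta> \<in> Lam 1 0 x"
  shows "\<eta> = (\<lambda>vs. \<eta> [frame_vec 1 x 1] * wedge [phi 1 x] vs
    + \<eta> [frame_vec 2 x 1] * wedge [phi 2 x] vs + \<eta> [frame_vec 3 x 1] * wedge [phi 3 x] vs)"
  using assms unfolding Lam_def
proof (induction \<eta> rule: lin_span_c_induct)
  case zero
  then show ?case by simp
next
  case (add \<eta> c g)
  from add.hyps(2) obtain i where "g = wedge [phi i x]" "i \<in> {1,2,3}"
    unfolding gens_def by (auto simp: length_Suc_conv)
  then have "g vs = g [frame_vec 1 x 1] * wedge [phi 1 x] vs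
    + g [frame_vec 2 x 1] * wedge [phi 2 x] vs + g [frame_vec 3 x 1] * wedge [phi 3 x] vs" for vs
    by (auto simp: wedge_Cons cwedge_Cons wedge_Nil phi_frame_vec)
  note g = this
  show ?case
  proof
    fix vs
    show "\<eta> vs + c * g vs =
      (\<eta> [frame_vec 1 x 1] + c * g [frame_vec 1 x 1]) * wedge [phi 1 x] vs
      + (\<eta> [frame_vec 2 x 1] + c * g [frame_vec 2 x 1]) * wedge [phi 2 x] vs
      + (\<eta> [frame_vec 3 x 1] + c * g [frame_vec 3 x 1]) * wedge [phi 3 x] vs"
      by (subst fun_cong[OF add.IH, of vs], subst g[of vs]) (simp add: algebra_simps)
  qed
qed

lemma Lam_2_0_expand:
  assumes "\<eta> \<in> Lam 2 0 x"
  shows "\<eta> = (\<lambda>vs. \<eta> [frame_vec 1 x 1, frame_vec 2 x 1] * wedge [phi 1 x, phi 2 x] vs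
    + \<eta> [frame_vec 1 x 1, frame_vec 3 x 1] * wedge [phi 1 x, phi 3 x] vs
    + \<eta> [frame_vec 2 x 1, frame_vec 3 x 1] * wedge [phi 2 x, phi 3 x] vs)"
  using assms unfolding Lam_def
proof (induction \<eta> rule: lin_span_c_induct)
  case zero
  then show ?case by simp
next
  case (add \<eta> c g)
  from add.hyps(2) obtain i j where "g = wedge [phi i x, phi j x]" "i \<in> {1,2,3}" "j \<in> {1,2,3}"
    unfolding gens_def by (auto simp: length_Suc_conv numeral_2_eq_2)
  then have "g vs = g [frame_vec 1 x 1, frame_vec 2 x 1] * wedge [phi 1 x, phi 2 x] vs
    + g [frame_vec 1 x 1, frame_vec 3 x 1] * wedge [phi 1 x, phi 3 x] vs
    + g [frame_vec 2 x 1, frame_vec 3 x 1] * wedge [phi 2 x, phi 3 x] vs" for vs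
    by (elim insertE emptyE; simp add: wedge_Cons cwedge_normalize; simp add: cwedge_Cons wedge_Nil phi_frame_vec cwedge_linear)
  note g = this
  show ?case
  proof
    fix vs
    show "\<eta> vs + c * g vs =
      (\<eta> [frame_vec 1 x 1, frame_vec 2 x 1] + c * g [frame_vec 1 x 1, frame_vec 2 x 1]) * wedge [phi 1 x, phi 2 x] vs
      + (\<eta> [frame_vec 1 x 1, frame_vec 3 x 1] + c * g [frame_vec 1 x 1, frame_vec 3 x 1]) * wedge [phi 1 x, phi 3 x] vs
      + (\<eta> [frame_vec 2 x 1, frame_vec 3 x 1] + c * g [frame_vec 2 x 1, frame_vec 3 x 1]) * wedge [phi 2 x, phi 3 x] vs"
      by (subst fun_cong[OF add.IH, of vs], subst g[of vs]) (simp add: algebra_simps)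
  qed
qed

lemma Lam_3_0_expand:
  assumes "\<eta> \<in> Lam 3 0 x"
  shows "\<eta> = (\<lambda>vs. \<eta> [frame_vec 1 x 1, frame_vec 2 x 1, frame_vec 3 x 1] * wedge [phi 1 x, phi 2 x, phi 3 x] vs)"
  using assms unfolding Lam_def
proof (induction \<eta> rule: lin_span_c_induct)
  case zero
  then show ?case by simp
next
  case (add \<eta> c g)
  from add.hyps(2) obtain i j k where "g = wedge [phi i x, phi j x, phi k x]"
    "i \<in> {1,2,3}" "j \<in> {1,2,3}" "k \<in> {1,2,3}"
    unfolding gens_def by (auto simp: length_Suc_conv numeral_3_eq_3)
  then have "g vs = g [frame_vec 1 x 1, frame_vec 2 x 1, frame_vec 3 x 1] * wedge [phi 1 x, phi 2 x, phi 3 x] vs" for vs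
    by (elim insertE emptyE; simp add: wedge_Cons cwedge_normalize; simp add: cwedge_Cons wedge_Nil phi_frame_vec cwedge_linear)
  note g = this
  show ?case
  proof
    fix vs
    show "\<eta> vs + c * g vs =
      (\<eta> [frame_vec 1 x 1, frame_vec 2 x 1, frame_vec 3 x 1] + c * g [frame_vec 1 x 1, frame_vec 2 x 1, frame_vec 3 x 1]) * wedge [phi 1 x, phi 2 x, phi 3 x] vs"
      by (subst fun_cong[OF add.IH, of vs], subst g[of vs]) (simp add: algebra_simps)
  qed
qed

section \<open>The operator \<open>dbar\<close> written out in degrees one, two and three\<close>

lemma has_dbar_wedge_phi_1: "j \<in> {1,2,3} \<Longrightarrow> has_dbar 1 (\<lambda>y. wedge [phi j y]) x (dbar_phi j x (wedge []))"
  using has_dbar_cwedge_phi[OF has_dbar_wedge_Nil, of j x] by (simp add: wedge_Cons cwedge_linear)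

lemma has_dbar_wedge_phi_Cons:
  assumes "has_dbar p (\<lambda>y. wedge (as y)) x \<theta>" "j \<in> {1,2,3}"
  shows "has_dbar (Suc p) (\<lambda>y. wedge (phi j y # as y)) x
    (\<lambda>vs. dbar_phi j x (wedge (as x)) vs - cwedge (phi j x) \<theta> vs)"
  using has_dbar_cwedge_phi[OF assms] by (simp add: wedge_Cons)

text \<open>The minus signs at \<open>Vbarfield\<close> come from moving \<open>phibar k\<close>
  behind \<open>phi j\<close>; the quarters are the coefficients of \<open>dbar_phi\<close>, which
  vanishes for \<open>phi 3\<close>.\<close>

lemma has_dbar_1_0:
  assumes "f1 differentiable (at x)" "f2 differentiable (at x)" "f3 differentiable (at x)"
  shows "has_dbar 1 (\<lambda>y vs. f1 y * wedge [phi 1 y] vs + f2 y * wedge [phi 2 y] vs + f3 y * wedge [phi 3 y] vs) x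
   (\<lambda>vs. - Vbarfield 1 f1 x * wedge [phi 1 x, phibar 1 x] vs
      + - Vbarfield 2 f1 x * wedge [phi 1 x, phibar 2 x] vs
      + (- Vbarfield 3 f1 x + f1 x / 4 - \<i> / 4 * f2 x) * wedge [phi 1 x, phibar 3 x] vs
      + - Vbarfield 1 f2 x * wedge [phi 2 x, phibar 1 x] vs
      + - Vbarfield 2 f2 x * wedge [phi 2 x, phibar 2 x] vs
      + (- Vbarfield 3 f2 x - \<i> / 4 * f1 x - f2 x / 4) * wedge [phi 2 x, phibar 3 x] vs
      + (- Vbarfield 1 f3 x + f1 x / 4 + \<i> / 4 * f2 x) * wedge [phi 3 x, phibar 1 x] vs
      + (- Vbarfield 2 f3 x + \<i> / 4 * f1 x - f2 x / 4) * wedge [phi 3 x, phibar 2 x] vs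
      + - Vbarfield 3 f3 x * wedge [phi 3 x, phibar 3 x] vs)"
proof -
  have W: "has_dbar 1 (\<lambda>y. wedge [phi j y]) x (dbar_phi j x (wedge []))" if "j \<in> {1,2,3}" for j
    using has_dbar_wedge_phi_1 that by blast
  note has_dbar_add[OF has_dbar_add[OF has_dbar_scale[OF W[of 1] assms(1)]
      has_dbar_scale[OF W[of 2] assms(2)]] has_dbar_scale[OF W[of 3] assms(3)]]
  then show ?thesis
    by (rule back_subst[of "has_dbar _ _ _"])
      (auto simp: wedge_Cons cwedge_normalize dbar_phi_def algebra_simps add_divide_distrib diff_divide_distrib)
qed

lemma has_dbar_2_0:
  assumes "f12 differentiable (at x)" "f13 differentiable (at x)" "f23 differentiable (at x)"
  shows "has_dbar 2 (\<lambda>y vs. f12 y * wedge [phi 1 y, phi 2 y] vs + f13 y * wedge [phi 1 y, phi 3 y] vs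
        + f23 y * wedge [phi 2 y, phi 3 y] vs) x
   (\<lambda>vs. Vbarfield 1 f12 x * wedge [phi 1 x, phi 2 x, phibar 1 x] vs
      + Vbarfield 2 f12 x * wedge [phi 1 x, phi 2 x, phibar 2 x] vs
      + Vbarfield 3 f12 x * wedge [phi 1 x, phi 2 x, phibar 3 x] vs
      + (Vbarfield 1 f13 x - \<i> / 4 * f12 x) * wedge [phi 1 x, phi 3 x, phibar 1 x] vs
      + (Vbarfield 2 f13 x + f12 x / 4) * wedge [phi 1 x, phi 3 x, phibar 2 x] vs
      + (Vbarfield 3 f13 x - f13 x / 4 + \<i> / 4 * f23 x) * wedge [phi 1 x, phi 3 x, phibar 3 x] vs
      + (Vbarfield 1 f23 x + f12 x / 4) * wedge [phi 2 x, phi 3 x, phibar 1 x] vs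
      + (Vbarfield 2 f23 x + \<i> / 4 * f12 x) * wedge [phi 2 x, phi 3 x, phibar 2 x] vs
      + (Vbarfield 3 f23 x + \<i> / 4 * f13 x + f23 x / 4) * wedge [phi 2 x, phi 3 x, phibar 3 x] vs)"
proof -
  have W: "has_dbar 2 (\<lambda>y. wedge [phi i y, phi j y]) x
      (\<lambda>vs. dbar_phi i x (wedge [phi j x]) vs - cwedge (phi i x) (dbar_phi j x (wedge [])) vs)"
    if "i \<in> {1,2,3}" "j \<in> {1,2,3}" for i j
    using has_dbar_wedge_phi_Cons[OF has_dbar_wedge_phi_1[OF that(2)] that(1)] by (simp add: numeral_2_eq_2)
  note has_dbar_add[OF has_dbar_add[OF has_dbar_scale[OF W[of 1 2] assms(1)]
      has_dbar_scale[OF W[of 1 3] assms(2)]] has_dbar_scale[OF W[of 2 3] assms(3)]]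
  then show ?thesis
    by (rule back_subst[of "has_dbar _ _ _"])
      (auto simp: wedge_Cons dbar_phi_def[abs_def] cwedge_normalize algebra_simps add_divide_distrib diff_divide_distrib)
qed

text \<open>No zeroth-order term survives: apart from products with a repeated factor there remain
  only the \<open>phi 1\<close>, \<open>phibar 3\<close> term of \<open>dbar_phi 1\<close> and the
  \<open>phi 2\<close>, \<open>phibar 3\<close> term of \<open>dbar_phi 2\<close>, whose
  coefficients 1/4 and -1/4 cancel.\<close>

lemma has_dbar_3_0:
  assumes "f differentiable (at x)"
  shows "has_dbar 3 (\<lambda>y vs. f y * wedge [phi 1 y, phi 2 y, phi 3 y] vs) x
   (\<lambda>vs. - Vbarfield 1 f x * wedge [phi 1 x, phi 2 x, phi 3 x, phibar 1 x] vs
      + - Vbarfield 2 f x * wedge [phi 1 x, phi 2 x, phi 3 x, phibar 2 x] vs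
      + - Vbarfield 3 f x * wedge [phi 1 x, phi 2 x, phi 3 x, phibar 3 x] vs)"
proof -
  have W: "has_dbar 3 (\<lambda>y. wedge [phi 1 y, phi 2 y, phi 3 y]) x
      (\<lambda>vs. dbar_phi 1 x (wedge [phi 2 x, phi 3 x]) vs - cwedge (phi 1 x)
        (\<lambda>vs. dbar_phi 2 x (wedge [phi 3 x]) vs - cwedge (phi 2 x) (dbar_phi 3 x (wedge [])) vs) vs)"
    using has_dbar_wedge_phi_Cons[OF has_dbar_wedge_phi_Cons[OF has_dbar_wedge_phi_1[of 3 x], of 2], of 1]
    by (simp add: numeral_3_eq_3)
  from has_dbar_scale[OF W assms] show ?thesis
    by (rule back_subst[of "has_dbar _ _ _"])
      (auto simp: wedge_Cons dbar_phi_def[abs_def] cwedge_normalize algebra_simps add_divide_distrib diff_divide_distrib)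
qed

section \<open>The differential equations for the coefficients\<close>

lemma bounded_linear_frame_vec: "bounded_linear (frame_vec k x)"
proof -
  have "linear (frame_vec k x)"
    by (rule linearI) (auto simp: frame_vec_def frame_def complex_eq_iff algebra_simps)
  then show ?thesis by (rule linear_conv_bounded_linear[THEN iffD1])
qed

text \<open>The frame depends on the point only through its first coordinate and only for
  \<open>k\<close> = 3, a direction that leaves this coordinate fixed. Each field is therefore
  constant along its own complex line.\<close>

lemma frame_vec_translate: "frame_vec k (x + frame_vec k x z) = frame_vec k x"
  by (rule ext) (auto simp: frame_vec_def frame_def complex_eq_iff)

text \<open>The integral curves of the real and imaginary parts of \<open>Vbarfield k\<close> through a point span a
  complex line, on which \<open>Vbarfield k\<close> is the Cauchy-Riemann operator.\<close>

lemma Vbarfield_constant_imp: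
  assumes diff: "\<And>x. f differentiable (at x)"
    and bnd: "bounded (range f)"
    and V: "\<And>x. Vbarfield k f x = c"
  shows "c = 0" and "f (x + frame_vec k x z) = f x"
proof -
  obtain M where M: "norm (f y) \<le> M" for y using bnd by (auto simp: bounded_iff)
  define F where "F = (\<lambda>z. f (x + frame_vec k x z))"
  define F' where "F' = (\<lambda>z h. frechet_derivative f (at (x + frame_vec k x z)) (frame_vec k x h))"
  have der: "(F has_derivative F' z) (at z)" for z
  proof -
    have "((\<lambda>z. x + frame_vec k x z) has_derivative (\<lambda>h. 0 + frame_vec k x h)) (at z)"
      by (rule has_derivative_add[OF has_derivative_const
            bounded_linear_imp_has_derivative[OF bounded_linear_frame_vec]])
    then have "((\<lambda>z. x + frame_vec k x z) has_derivative frame_vec k x) (at z)" by simp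
    moreover have "(f has_derivative frechet_derivative f (at (x + frame_vec k x z))) (at (x + frame_vec k x z))"
      using diff by (simp only: frechet_derivative_works)
    ultimately show ?thesis unfolding F_def F'_def by (rule has_derivative_compose)
  qed
  \<comment> \<open>The factor 2 undoes the division by 2 in \<open>Vbarfield\<close>, which the
    statement on the plane does not have.\<close>
  have dbar: "F' z 1 + \<i> * F' z \<i> = 2 * c" for z
    using V[of "x + frame_vec k x z"] by (simp add: F'_def Vbarfield_def frame_vec_translate)
  have bnd': "norm (F z) \<le> M" for z by (simp add: F_def M)
  show "c = 0" using Liouville_dbar_constant(1)[OF der dbar bnd'] by simp
  have "frame_vec k x 0 = 0" by (rule linear_0[OF bounded_linear.linear[OF bounded_linear_frame_vec]])
  then show "f (x + frame_vec k x z) = f x"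
    using Liouville_dbar_constant(2)[OF der dbar bnd', of z] by (simp add: F_def)
qed

text \<open>The lines of the three directions connect every point with 0.\<close>

lemma Vbarfield_zero_imp_constant:
  assumes "\<And>x. f differentiable (at x)" "bounded (range f)"
    and V: "\<And>k x. k \<in> {1,2,3} \<Longrightarrow> Vbarfield k f x = 0"
  shows "f x = f 0"
proof -
  have inv: "f (y + frame_vec k y z) = f y" if "k \<in> {1,2,3}" for k y z
    using Vbarfield_constant_imp(2)[OF assms(1,2) V[OF that]] .
  obtain a b c where x: "x = (a, b, c)" by (cases x)
  \<comment> \<open>Direction 3 is used first, while the first coordinate is 0, so that it sets the
    second coordinate without moving the third. Direction 1 then supplies \<open>Re a\<close> and
    \<open>Im c\<close>, direction 2 \<open>Im a\<close> and \<open>Re c\<close>.\<close>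
  define y where "y = 0 + frame_vec 3 0 b"
  define y' where "y' = y + frame_vec 1 y (Complex (Re a) (Im c))"
  have "x = y' + frame_vec 2 y' (Complex (Im a) (Re c))"
    by (simp add: x y'_def y_def frame_vec_def frame_def complex_eq_iff)
  then have "f x = f y'" by (simp add: inv)
  also have "\<dots> = f y" unfolding y'_def by (simp add: inv)
  also have "\<dots> = f 0" unfolding y_def by (rule inv) simp
  finally show ?thesis .
qed

lemma Vbarfield_add_scaled:
  assumes "f differentiable (at x)" "g differentiable (at x)"
  shows "Vbarfield k (\<lambda>x. f x + a * g x) x = Vbarfield k f x + a * Vbarfield k g x"
proof -
  have *: "((\<lambda>x. f x + a * g x) has_derivative (\<lambda>u. frechet_derivative f (at x) u +
      a * frechet_derivative g (at x) u)) (at x)"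
    using assms by (intro has_derivative_add has_derivative_mult_right)
      (simp_all only: frechet_derivative_works)
  show ?thesis
    unfolding Vbarfield_def frechet_derivative_at[OF *, symmetric]
    by (simp add: algebra_simps add_divide_distrib)
qed

lemma Vbarfield_const: "Vbarfield k (\<lambda>x. c) x = 0"
  by (simp add: Vbarfield_def frechet_derivative_const)

lemma bounded_range_add_scaled:
  fixes f g :: "'a \<Rightarrow> complex"
  assumes "bounded (range f)" "bounded (range g)"
  shows "bounded (range (\<lambda>x. f x + a * g x))"
proof -
  obtain M N where "\<And>x. norm (f x) \<le> M" "\<And>x. norm (g x) \<le> N"
    using assms by (auto simp: bounded_iff)
  then have "norm (f x + a * g x) \<le> M + norm a * N" for x
    by (intro norm_triangle_mono) (auto simp: norm_mult intro: mult_left_mono)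
  then show ?thesis by (auto simp: bounded_iff)
qed

text \<open>In the combinations \<open>g - \<i> * h\<close> and \<open>g + \<i> * h\<close> the system becomes triangular.\<close>

lemma Vbarfield_system:
  assumes diff: "\<And>x. g differentiable (at x)" "\<And>x. h differentiable (at x)"
    and bnd: "bounded (range g)" "bounded (range h)"
    and V12: "\<And>k x. k \<in> {1,2} \<Longrightarrow> Vbarfield k g x = 0" "\<And>k x. k \<in> {1,2} \<Longrightarrow> Vbarfield k h x = 0"
    and V3: "\<And>x. Vbarfield 3 g x = (g x - \<i> * h x) / 4" "\<And>x. Vbarfield 3 h x = - (\<i> * g x + h x) / 4"
  shows "\<exists>c. \<forall>x. g x = \<i> * c \<and> h x = c"
proof -
  define u where "u = (\<lambda>x. g x + (- \<i>) * h x)"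
  define w where "w = (\<lambda>x. g x + \<i> * h x)"
  have du: "u differentiable (at x)" and dw: "w differentiable (at x)" for x
    unfolding u_def w_def using diff by (auto intro!: differentiable_add differentiable_mult differentiable_diff)
  have bu: "bounded (range u)" and bw: "bounded (range w)"
    unfolding u_def w_def by (intro bounded_range_add_scaled bnd)+
  have V: "Vbarfield k u x = Vbarfield k g x + (- \<i>) * Vbarfield k h x"
    "Vbarfield k w x = Vbarfield k g x + \<i> * Vbarfield k h x" for k x
    unfolding u_def w_def by (intro Vbarfield_add_scaled diff)+
  have "Vbarfield k u x = 0" if "k \<in> {1,2,3}" for k x
  proof (cases "k = 3")
    case True
    then show ?thesis by (simp add: V V3 algebra_simps add_divide_distrib diff_divide_distrib)
  qed (use that V12(1)[of k x] V12(2)[of k x] in \<open>simp add: V\<close>)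
  then have u: "u x = u 0" for x by (rule Vbarfield_zero_imp_constant[OF du bu])
  \<comment> \<open>At this stage \<open>u\<close> is only known to be constant; it is the
    boundedness of \<open>w\<close> that forces the constant to be zero.\<close>
  have "Vbarfield 3 w x = u x / 2" for x
    by (simp add: V V3 u_def algebra_simps add_divide_distrib diff_divide_distrib)
  then have V3w: "Vbarfield 3 w x = u 0 / 2" for x using u by simp
  then have "u 0 / 2 = 0" by (rule Vbarfield_constant_imp(1)[OF dw bw])
  then have u0: "u x = 0" for x using u[of x] by simp
  have "Vbarfield k w x = 0" if "k \<in> {1,2,3}" for k x
  proof (cases "k = 3")
    case True
    then show ?thesis using V3w[of x] \<open>u 0 / 2 = 0\<close> by simp
  qed (use that V12(1)[of k x] V12(2)[of k x] in \<open>simp add: V\<close>)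
  then have w: "w x = w 0" for x by (rule Vbarfield_zero_imp_constant[OF dw bw])
  have gh: "g x = \<i> * h x" for x using u0[of x] by (simp add: u_def)
  then have "h x = w x / (2 * \<i>)" for x by (simp add: w_def)
  then have "h x = h 0" for x using w[of x] by metis
  then have "\<forall>x. g x = \<i> * h 0 \<and> h x = h 0" using gh by metis
  then show ?thesis by blast
qed

section \<open>Invariance, boundedness and differentiability of the coefficients\<close>

lemma frame_vec_Hmul:
  "frame_vec k (Hmul \<gamma> x) c = frechet_derivative (Hmul \<gamma>) (at x) (frame_vec k x c)"
  by (simp add: frechet_derivative_Hmul frame_vec_def frame_def Hmul_def algebra_simps)

lemma Apq_coefficient_invariant:
  assumes "\<psi> \<in> Apq p q" "\<gamma> \<in> Gamma"
  shows "\<psi> (Hmul \<gamma> x) (map (\<lambda>k. frame_vec k (Hmul \<gamma> x) 1) I) = \<psi> x (map (\<lambda>k. frame_vec k x 1) I)"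
proof -
  have "pullback (Hmul \<gamma>) \<psi> x (map (\<lambda>k. frame_vec k x 1) I) = \<psi> x (map (\<lambda>k. frame_vec k x 1) I)"
    using assms by (simp add: Apq_def)
  then show ?thesis by (simp add: pullback_def frame_vec_Hmul o_def)
qed

lemma Apq_coefficient_bounded:
  assumes "\<psi> \<in> Apq p q" "\<And>x. (\<lambda>x. \<psi> x (map (\<lambda>k. frame_vec k x 1) I)) differentiable (at x)"
  shows "bounded (range (\<lambda>x. \<psi> x (map (\<lambda>k. frame_vec k x 1) I)))"
proof (rule Gamma_invariant_bounded)
  show "continuous_on UNIV (\<lambda>x. \<psi> x (map (\<lambda>k. frame_vec k x 1) I))"
    using assms(2) by (simp add: continuous_on_eq_continuous_at differentiable_imp_continuous_within)
qed (rule Apq_coefficient_invariant[OF assms(1)])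

lemma frame_vec_12:
  "frame_vec 1 x c = (of_real (Re c), 0, \<i> * of_real (Im c))"
  "frame_vec 2 x c = (\<i> * of_real (Re c), 0, of_real (Im c))"
  by (simp_all add: frame_vec_def frame_def complex_eq_iff)

lemma Apq_imp_Lam: "\<psi> \<in> Apq p q \<Longrightarrow> \<psi> x \<in> Lam p q x"
  unfolding Apq_def by blast

lemma Apq_differentiable: "\<psi> \<in> Apq p q \<Longrightarrow> (\<lambda>x. \<psi> x vs) differentiable (at x)"
  by (auto simp: Apq_def intro: Cinf_differentiable)

lemma phi_differentiable: "(\<lambda>x. phi j x v) differentiable (at x)"
  by (rule Cinf_differentiable[OF Cinf_phi])

lemma phi_3_unit: "phi 3 x (0, 1, 0) = 1"
  by (simp add: phi_def e3_def e4_def)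

text \<open>Smoothness in \<open>Apq\<close> concerns values on fixed vectors. Frame vectors 1 and 2
  are fixed, but \<open>frame_vec 3 x 1\<close> moves with the point; the expansion is therefore
  evaluated at the fixed vector \<open>(0, 1, 0)\<close>, where \<open>phi 3\<close> is 1, and
  solved for the third coefficient.\<close>

lemma Apq_1_0_coefficients_differentiable:
  assumes "\<psi> \<in> Apq 1 0" "k \<in> {1,2,3}"
  shows "(\<lambda>x. \<psi> x [frame_vec k x 1]) differentiable (at x)"
proof -
  note L = Apq_imp_Lam[OF assms(1)]
  have 12: "(\<lambda>x. \<psi> x [frame_vec 1 x 1]) differentiable (at x)"
    "(\<lambda>x. \<psi> x [frame_vec 2 x 1]) differentiable (at x)" for x
    unfolding frame_vec_12 by (rule Apq_differentiable[OF assms(1)])+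
  have "\<psi> x [frame_vec 3 x 1] = \<psi> x [(0, 1, 0)] - \<psi> x [frame_vec 1 x 1] * phi 1 x (0, 1, 0)
      - \<psi> x [frame_vec 2 x 1] * phi 2 x (0, 1, 0)" for x
    using fun_cong[OF Lam_1_0_expand[OF L], of x "[(0, 1, 0)]"]
    by (simp add: wedge_Cons cwedge_Cons wedge_Nil phi_3_unit)
  then have "(\<lambda>x. \<psi> x [frame_vec 3 x 1]) differentiable (at x)"
    by (simp only:) (intro differentiable_diff differentiable_mult 12 phi_differentiable
        Apq_differentiable[OF assms(1)])
  then show ?thesis using 12[of x] assms(2) by auto
qed

lemma Apq_2_0_coefficients_differentiable:
  assumes "\<psi> \<in> Apq 2 0" "(i, j) \<in> {(1,2),(1,3),(2,3)}"
  shows "(\<lambda>x. \<psi> x [frame_vec i x 1, frame_vec j x 1]) differentiable (at x)"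
proof -
  note L = Apq_imp_Lam[OF assms(1)]
  have 12: "(\<lambda>x. \<psi> x [frame_vec 1 x 1, frame_vec 2 x 1]) differentiable (at x)"
    "(\<lambda>x. \<psi> x [frame_vec 1 x 1, (0, 1, 0)]) differentiable (at x)"
    "(\<lambda>x. \<psi> x [frame_vec 2 x 1, (0, 1, 0)]) differentiable (at x)" for x
    unfolding frame_vec_12 by (rule Apq_differentiable[OF assms(1)])+
  have "\<psi> x [frame_vec 1 x 1, frame_vec 3 x 1] = \<psi> x [frame_vec 1 x 1, (0, 1, 0)]
      - \<psi> x [frame_vec 1 x 1, frame_vec 2 x 1] * phi 2 x (0, 1, 0)" for x
    using fun_cong[OF Lam_2_0_expand[OF L], of x "[frame_vec 1 x 1, (0, 1, 0)]"]
    by (simp add: wedge_Cons cwedge_Cons wedge_Nil phi_3_unit phi_frame_vec cwedge_linear)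
  then have 13: "(\<lambda>x. \<psi> x [frame_vec 1 x 1, frame_vec 3 x 1]) differentiable (at x)"
    by (simp only:) (intro differentiable_diff differentiable_mult 12 phi_differentiable)
  have "\<psi> x [frame_vec 2 x 1, frame_vec 3 x 1] = \<psi> x [frame_vec 2 x 1, (0, 1, 0)]
      + \<psi> x [frame_vec 1 x 1, frame_vec 2 x 1] * phi 1 x (0, 1, 0)" for x
    using fun_cong[OF Lam_2_0_expand[OF L], of x "[frame_vec 2 x 1, (0, 1, 0)]"]
    by (simp add: wedge_Cons cwedge_Cons wedge_Nil phi_3_unit phi_frame_vec cwedge_linear)
  then have 23: "(\<lambda>x. \<psi> x [frame_vec 2 x 1, frame_vec 3 x 1]) differentiable (at x)"
    by (simp only:) (intro differentiable_add differentiable_mult 12 phi_differentiable)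
  show ?thesis using 12(1)[of x] 13 23 assms(2) by auto
qed

text \<open>Replacing the moving vector by \<open>(0, 1, 0)\<close> costs no correction here: the
  first two slots already use up \<open>phi 1\<close> and \<open>phi 2\<close>.\<close>

lemma Apq_3_0_coefficient_differentiable:
  assumes "\<psi> \<in> Apq 3 0"
  shows "(\<lambda>x. \<psi> x [frame_vec 1 x 1, frame_vec 2 x 1, frame_vec 3 x 1]) differentiable (at x)"
proof -
  note L = Apq_imp_Lam[OF assms]
  have "(\<lambda>x. \<psi> x [frame_vec 1 x 1, frame_vec 2 x 1, (0, 1, 0)]) differentiable (at x)"
    unfolding frame_vec_12 by (rule Apq_differentiable[OF assms(1)])
  moreover have "\<psi> x [frame_vec 1 x 1, frame_vec 2 x 1, frame_vec 3 x 1] =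
      \<psi> x [frame_vec 1 x 1, frame_vec 2 x 1, (0, 1, 0)]" for x
    using fun_cong[OF Lam_3_0_expand[OF L], of x "[frame_vec 1 x 1, frame_vec 2 x 1, (0, 1, 0)]"]
    by (simp add: wedge_Cons cwedge_Cons wedge_Nil phi_3_unit phi_frame_vec cwedge_linear)
  ultimately show ?thesis by (simp only:)
qed

lemma wedge_phi_Apq:
  assumes "set I \<subseteq> {1,2,3}" "length I = p"
  shows "(\<lambda>x vs. c * wedge (map (\<lambda>j. phi j x) I) vs) \<in> Apq p 0"
  unfolding Apq_def
proof (intro CollectI conjI allI ballI)
  show "Cinf (\<lambda>x. c * wedge (map (\<lambda>j. phi j x) I) vs)" for vs
    by (rule Cinf_mult[OF Cinf_const Cinf_wedge_phi])
  have "wedge (map (\<lambda>j. phi j x) I @ map (\<lambda>j. phibar j x) []) \<in> gens p 0 x" for x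
    using assms unfolding gens_def by (intro CollectI exI conjI) auto
  then show "(\<lambda>vs. c * wedge (map (\<lambda>j. phi j x) I) vs) \<in> Lam p 0 x" for x
    unfolding Lam_def by (intro lin_span_c_scale lin_span_c_base) simp
  have "pullback (Hmul \<gamma>) (\<lambda>x vs. c * \<omega> x vs) = (\<lambda>x vs. c * pullback (Hmul \<gamma>) \<omega> x vs)" for \<gamma> \<omega>
    by (intro ext) (simp only: pullback_def)
  then show "pullback (Hmul \<gamma>) (\<lambda>x vs. c * wedge (map (\<lambda>j. phi j x) I) vs) =
      (\<lambda>x vs. c * wedge (map (\<lambda>j. phi j x) I) vs)" for \<gamma>
    by (simp only: pullback_wedge_phi)
qed

lemma Apq_add:
  assumes "\<phi> \<in> Apq p q" "\<psi> \<in> Apq p q"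
  shows "(\<lambda>x vs. \<phi> x vs + \<psi> x vs) \<in> Apq p q"
  unfolding Apq_def
proof (intro CollectI conjI allI ballI)
  show "Cinf (\<lambda>x. \<phi> x vs + \<psi> x vs)" for vs
    using assms unfolding Apq_def by (intro Cinf_add) blast+
  show "(\<lambda>vs. \<phi> x vs + \<psi> x vs) \<in> Lam p q x" for x
    using assms by (intro Lam_intros(2) Apq_imp_Lam)
  fix \<gamma> assume "\<gamma> \<in> Gamma"
  then have "pullback (Hmul \<gamma>) \<phi> = \<phi>" "pullback (Hmul \<gamma>) \<psi> = \<psi>"
    using assms unfolding Apq_def by blast+
  moreover have "pullback (Hmul \<gamma>) (\<lambda>x vs. \<phi> x vs + \<psi> x vs) =
      (\<lambda>x vs. pullback (Hmul \<gamma>) \<phi> x vs + pullback (Hmul \<gamma>) \<psi> x vs)"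
    by (intro ext) (simp only: pullback_def)
  ultimately show "pullback (Hmul \<gamma>) (\<lambda>x vs. \<phi> x vs + \<psi> x vs) = (\<lambda>x vs. \<phi> x vs + \<psi> x vs)"
    by (simp only:)
qed

section \<open>The closed forms in each degree\<close>

lemma dbar_closed_1_0: "dbar_closed_p0 1 = cline (\<lambda>x. wedge [phi 3 x])"
proof (intro equalityI subsetI)
  fix \<psi> assume "\<psi> \<in> dbar_closed_p0 1"
  then have \<psi>: "\<psi> \<in> Apq 1 0" and closed: "dbar 1 0 \<psi> x = (\<lambda>vs. 0)" for x
    by (auto simp: dbar_closed_p0_def)
  define f where "f = (\<lambda>k x. \<psi> x [frame_vec k x 1])"
  have eq: "\<psi> = (\<lambda>y vs. f 1 y * wedge [phi 1 y] vs + f 2 y * wedge [phi 2 y] vs + f 3 y * wedge [phi 3 y] vs)"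
  proof
    fix y
    from Lam_1_0_expand[OF Apq_imp_Lam[OF \<psi>]]
    show "\<psi> y = (\<lambda>vs. f 1 y * wedge [phi 1 y] vs + f 2 y * wedge [phi 2 y] vs + f 3 y * wedge [phi 3 y] vs)"
      unfolding f_def .
  qed
  note closed' = closed[unfolded arg_cong[OF eq, of "dbar 1 0"]]
  have diff: "f k differentiable (at x)" if "k \<in> {1,2,3}" for k x
    unfolding f_def by (rule Apq_1_0_coefficients_differentiable[OF \<psi> that])
  have bnd: "bounded (range (f k))" if "k \<in> {1,2,3}" for k
    using Apq_coefficient_bounded[OF \<psi>, of "[k]"] diff[OF that] by (simp add: f_def)
  have E: "- Vbarfield 1 (f 1) x = 0 \<and> - Vbarfield 2 (f 1) x = 0 \<and>
      - Vbarfield 3 (f 1) x + f 1 x / 4 - \<i> / 4 * f 2 x = 0 \<and>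
      - Vbarfield 1 (f 2) x = 0 \<and> - Vbarfield 2 (f 2) x = 0 \<and>
      - Vbarfield 3 (f 2) x - \<i> / 4 * f 1 x - f 2 x / 4 = 0 \<and>
      - Vbarfield 1 (f 3) x + f 1 x / 4 + \<i> / 4 * f 2 x = 0 \<and>
      - Vbarfield 2 (f 3) x + \<i> / 4 * f 1 x - f 2 x / 4 = 0 \<and> - Vbarfield 3 (f 3) x = 0" for x
    by (rule wedge_11_independent[of _ x],
        rule trans[OF has_dbar_imp_dbar[OF has_dbar_1_0, symmetric] closed'])
       (simp_all add: diff)
  have V31: "Vbarfield 3 (f 1) x = (f 1 x - \<i> * f 2 x) / 4" for x
  proof -
    have "(f 1 x - \<i> * f 2 x) / 4 - Vbarfield 3 (f 1) x = - Vbarfield 3 (f 1) x + f 1 x / 4 - \<i> / 4 * f 2 x"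
      by (simp add: add_divide_distrib diff_divide_distrib)
    also have "\<dots> = 0" using E[of x] by blast
    finally show ?thesis by simp
  qed
  have V32: "Vbarfield 3 (f 2) x = - (\<i> * f 1 x + f 2 x) / 4" for x
  proof -
    have "- (\<i> * f 1 x + f 2 x) / 4 - Vbarfield 3 (f 2) x = - Vbarfield 3 (f 2) x - \<i> / 4 * f 1 x - f 2 x / 4"
      by (simp add: add_divide_distrib diff_divide_distrib)
    also have "\<dots> = 0" using E[of x] by blast
    finally show ?thesis by simp
  qed
  have V13: "Vbarfield 1 (f 3) x = (f 1 x + \<i> * f 2 x) / 4" for x
  proof -
    have "(f 1 x + \<i> * f 2 x) / 4 - Vbarfield 1 (f 3) x = - Vbarfield 1 (f 3) x + f 1 x / 4 + \<i> / 4 * f 2 x"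
      by (simp add: add_divide_distrib diff_divide_distrib)
    also have "\<dots> = 0" using E[of x] by blast
    finally show ?thesis by simp
  qed
  have "\<exists>c. \<forall>x. f 1 x = \<i> * c \<and> f 2 x = c"
  proof (rule Vbarfield_system[OF _ _ _ _ _ _ V31 V32])
    show "Vbarfield k (f 1) x = 0" "Vbarfield k (f 2) x = 0" if "k \<in> {1, 2}" for k x
      using E[of x] that by auto
  qed (simp_all add: diff bnd)
  then obtain c where c: "f 1 x = \<i> * c" "f 2 x = c" for x by blast
  \<comment> \<open>This equation excludes the kernel direction: the bounded function
    \<open>f 3\<close> cannot have a nonzero constant derivative along
    \<open>Vbarfield 1\<close>.\<close>
  have "Vbarfield 1 (f 3) x = \<i> * c / 2" for x
    unfolding V13 c by simp
  then have "\<i> * c / 2 = 0" by (rule Vbarfield_constant_imp(1)[rotated 2]) (simp_all add: diff bnd)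
  then have "c = 0" by simp
  then have f12: "f 1 x = 0" "f 2 x = 0" for x using c by auto
  have "Vbarfield k (f 3) x = 0" if "k \<in> {1,2,3}" for k x
    using E[of x] f12[of x] that by auto
  then have "f 3 x = f 3 0" for x
    by (rule Vbarfield_zero_imp_constant[rotated 2]) (simp_all add: diff bnd)
  then obtain d where "f 3 x = d" for x by blast
  then have "\<psi> = (\<lambda>x vs. d * wedge [phi 3 x] vs)" unfolding eq f12 by simp
  then show "\<psi> \<in> cline (\<lambda>x. wedge [phi 3 x])" unfolding cline_def by blast
next
  fix \<psi> assume "\<psi> \<in> cline (\<lambda>x. wedge [phi 3 x])"
  then obtain c where \<psi>: "\<psi> = (\<lambda>x vs. c * wedge [phi 3 x] vs)" unfolding cline_def by blast
  have "\<psi> \<in> Apq 1 0" using wedge_phi_Apq[of "[3]" 1 c] by (simp add: \<psi>)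
  moreover have "dbar 1 0 \<psi> x = (\<lambda>vs. 0)" for x
    using has_dbar_imp_dbar[OF has_dbar_1_0[of "\<lambda>x. 0" x "\<lambda>x. 0" "\<lambda>x. c"]]
    by (simp add: \<psi> Vbarfield_const)
  ultimately show "\<psi> \<in> dbar_closed_p0 1" by (auto simp: dbar_closed_p0_def)
qed

lemma dbar_closed_2_0:
  "dbar_closed_p0 2 = cline (\<lambda>x vs. \<i> * wedge [phi 1 x, phi 3 x] vs + wedge [phi 2 x, phi 3 x] vs)"
proof (intro equalityI subsetI)
  fix \<psi> assume "\<psi> \<in> dbar_closed_p0 2"
  then have \<psi>: "\<psi> \<in> Apq 2 0" and closed: "dbar 2 0 \<psi> x = (\<lambda>vs. 0)" for x
    by (auto simp: dbar_closed_p0_def)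
  define f where "f = (\<lambda>i j x. \<psi> x [frame_vec i x 1, frame_vec j x 1])"
  have eq: "\<psi> = (\<lambda>y vs. f 1 2 y * wedge [phi 1 y, phi 2 y] vs + f 1 3 y * wedge [phi 1 y, phi 3 y] vs
      + f 2 3 y * wedge [phi 2 y, phi 3 y] vs)"
  proof
    fix y
    from Lam_2_0_expand[OF Apq_imp_Lam[OF \<psi>]]
    show "\<psi> y = (\<lambda>vs. f 1 2 y * wedge [phi 1 y, phi 2 y] vs + f 1 3 y * wedge [phi 1 y, phi 3 y] vs
      + f 2 3 y * wedge [phi 2 y, phi 3 y] vs)"
      unfolding f_def .
  qed
  note closed' = closed[unfolded arg_cong[OF eq, of "dbar 2 0"]]
  have diff: "f i j differentiable (at x)" if "(i, j) \<in> {(1,2),(1,3),(2,3)}" for i j x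
    unfolding f_def by (rule Apq_2_0_coefficients_differentiable[OF \<psi> that])
  have bnd: "bounded (range (f i j))" if "(i, j) \<in> {(1,2),(1,3),(2,3)}" for i j
    using Apq_coefficient_bounded[OF \<psi>, of "[i, j]"] diff[OF that] by (simp add: f_def)
  have E: "Vbarfield 1 (f 1 2) x = 0 \<and> Vbarfield 2 (f 1 2) x = 0 \<and> Vbarfield 3 (f 1 2) x = 0 \<and>
      Vbarfield 1 (f 1 3) x - \<i> / 4 * f 1 2 x = 0 \<and> Vbarfield 2 (f 1 3) x + f 1 2 x / 4 = 0 \<and>
      Vbarfield 3 (f 1 3) x - f 1 3 x / 4 + \<i> / 4 * f 2 3 x = 0 \<and>
      Vbarfield 1 (f 2 3) x + f 1 2 x / 4 = 0 \<and> Vbarfield 2 (f 2 3) x + \<i> / 4 * f 1 2 x = 0 \<and>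
      Vbarfield 3 (f 2 3) x + \<i> / 4 * f 1 3 x + f 2 3 x / 4 = 0" for x
    by (rule wedge_21_independent[of _ x],
        rule trans[OF has_dbar_imp_dbar[OF has_dbar_2_0, symmetric] closed'])
       (simp_all add: diff)
  have "Vbarfield k (f 1 2) x = 0" if "k \<in> {1,2,3}" for k x using E[of x] that by auto
  then have f12: "f 1 2 x = f 1 2 0" for x
    by (rule Vbarfield_zero_imp_constant[rotated 2]) (simp_all add: diff bnd)
  \<comment> \<open>The constant \<open>f 1 2\<close> is the derivative of the bounded
    \<open>f 1 3\<close> up to a factor, hence zero. What remains for \<open>f 1 3\<close> and
    \<open>f 2 3\<close> is the system of degree one without an equation that would fix
    \<open>c\<close>.\<close>
  have "Vbarfield 1 (f 1 3) x = \<i> / 4 * f 1 2 0" for x using E[of x] f12[of x] by simp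
  then have "\<i> / 4 * f 1 2 0 = 0" 
    by (rule Vbarfield_constant_imp(1)[rotated 2]) (simp_all add: diff bnd)
  then have f12: "f 1 2 x = 0" for x using f12[of x] by simp
  have V313: "Vbarfield 3 (f 1 3) x = (f 1 3 x - \<i> * f 2 3 x) / 4" for x
  proof -
    have "Vbarfield 3 (f 1 3) x - (f 1 3 x - \<i> * f 2 3 x) / 4 = Vbarfield 3 (f 1 3) x - f 1 3 x / 4 + \<i> / 4 * f 2 3 x"
      by (simp add: add_divide_distrib diff_divide_distrib)
    also have "\<dots> = 0" using E[of x] by blast
    finally show ?thesis by simp
  qed
  have V323: "Vbarfield 3 (f 2 3) x = - (\<i> * f 1 3 x + f 2 3 x) / 4" for x
  proof -
    have "Vbarfield 3 (f 2 3) x - - (\<i> * f 1 3 x + f 2 3 x) / 4 = Vbarfield 3 (f 2 3) x + \<i> / 4 * f 1 3 x + f 2 3 x / 4"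
      by (simp add: add_divide_distrib diff_divide_distrib)
    also have "\<dots> = 0" using E[of x] by blast
    finally show ?thesis by simp
  qed
  have "\<exists>c. \<forall>x. f 1 3 x = \<i> * c \<and> f 2 3 x = c"
  proof (rule Vbarfield_system[OF _ _ _ _ _ _ V313 V323])
    show "Vbarfield k (f 1 3) x = 0" "Vbarfield k (f 2 3) x = 0" if "k \<in> {1, 2}" for k x
      using E[of x] f12[of x] that by auto
  qed (simp_all add: diff bnd)
  then obtain c where c: "f 1 3 x = \<i> * c" "f 2 3 x = c" for x by blast
  have "\<psi> = (\<lambda>x vs. c * (\<i> * wedge [phi 1 x, phi 3 x] vs + wedge [phi 2 x, phi 3 x] vs))"
    unfolding eq c f12 by (simp add: algebra_simps)
  then show "\<psi> \<in> cline (\<lambda>x vs. \<i> * wedge [phi 1 x, phi 3 x] vs + wedge [phi 2 x, phi 3 x] vs)"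
    unfolding cline_def by blast
next
  fix \<psi> assume "\<psi> \<in> cline (\<lambda>x vs. \<i> * wedge [phi 1 x, phi 3 x] vs + wedge [phi 2 x, phi 3 x] vs)"
  then obtain c where "\<psi> = (\<lambda>x vs. c * (\<i> * wedge [phi 1 x, phi 3 x] vs + wedge [phi 2 x, phi 3 x] vs))"
    unfolding cline_def by blast
  then have \<psi>: "\<psi> = (\<lambda>x vs. (\<i> * c) * wedge [phi 1 x, phi 3 x] vs + c * wedge [phi 2 x, phi 3 x] vs)"
    by (simp add: algebra_simps)
  have "\<psi> \<in> Apq 2 0"
    using Apq_add[OF wedge_phi_Apq[of "[1, 3]" 2 "\<i> * c"] wedge_phi_Apq[of "[2, 3]" 2 c]] by (simp add: \<psi>)
  moreover have "dbar 2 0 \<psi> x = (\<lambda>vs. 0)" for x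
    using has_dbar_imp_dbar[OF has_dbar_2_0[of "\<lambda>x. 0" x "\<lambda>x. \<i> * c" "\<lambda>x. c"]]
    by (simp add: \<psi> Vbarfield_const)
  ultimately show "\<psi> \<in> dbar_closed_p0 2" by (auto simp: dbar_closed_p0_def)
qed

lemma dbar_closed_3_0: "dbar_closed_p0 3 = cline (\<lambda>x. wedge [phi 1 x, phi 2 x, phi 3 x])"
proof (intro equalityI subsetI)
  fix \<psi> assume "\<psi> \<in> dbar_closed_p0 3"
  then have \<psi>: "\<psi> \<in> Apq 3 0" and closed: "dbar 3 0 \<psi> x = (\<lambda>vs. 0)" for x
    by (auto simp: dbar_closed_p0_def)
  define f where "f = (\<lambda>x. \<psi> x [frame_vec 1 x 1, frame_vec 2 x 1, frame_vec 3 x 1])"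
  have eq: "\<psi> = (\<lambda>y vs. f y * wedge [phi 1 y, phi 2 y, phi 3 y] vs)"
  proof
    fix y
    from Lam_3_0_expand[OF Apq_imp_Lam[OF \<psi>]]
    show "\<psi> y = (\<lambda>vs. f y * wedge [phi 1 y, phi 2 y, phi 3 y] vs)" unfolding f_def .
  qed
  note closed' = closed[unfolded arg_cong[OF eq, of "dbar 3 0"]]
  have diff: "f differentiable (at x)" for x
    unfolding f_def by (rule Apq_3_0_coefficient_differentiable[OF \<psi>])
  have bnd: "bounded (range f)"
    using Apq_coefficient_bounded[OF \<psi>, of "[1, 2, 3]"] diff by (simp add: f_def)
  have E: "- Vbarfield 1 f x = 0 \<and> - Vbarfield 2 f x = 0 \<and> - Vbarfield 3 f x = 0" for x
    by (rule wedge_31_independent[of _ x],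
        rule trans[OF has_dbar_imp_dbar[OF has_dbar_3_0, symmetric] closed'])
       (simp_all add: diff)
  have "Vbarfield k f x = 0" if "k \<in> {1,2,3}" for k x using E[of x] that by auto
  then have "f x = f 0" for x
    by (rule Vbarfield_zero_imp_constant[rotated 2]) (simp_all add: diff bnd)
  then obtain d where "f x = d" for x by blast
  then have "\<psi> = (\<lambda>x vs. d * wedge [phi 1 x, phi 2 x, phi 3 x] vs)" by (subst eq) simp
  then show "\<psi> \<in> cline (\<lambda>x. wedge [phi 1 x, phi 2 x, phi 3 x])" unfolding cline_def by blast
next
  fix \<psi> assume "\<psi> \<in> cline (\<lambda>x. wedge [phi 1 x, phi 2 x, phi 3 x])"
  then obtain c where \<psi>: "\<psi> = (\<lambda>x vs. c * wedge [phi 1 x, phi 2 x, phi 3 x] vs)"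
    unfolding cline_def by blast
  have "\<psi> \<in> Apq 3 0" using wedge_phi_Apq[of "[1, 2, 3]" 3 c] by (simp add: \<psi>)
  moreover have "dbar 3 0 \<psi> x = (\<lambda>vs. 0)" for x
    using has_dbar_imp_dbar[OF has_dbar_3_0[of "\<lambda>x. c" x]] by (simp add: \<psi> Vbarfield_const)
  ultimately show "\<psi> \<in> dbar_closed_p0 3" by (auto simp: dbar_closed_p0_def)
qed

text \<open>Test vectors for nonvanishing; in degree two, frame vectors 2 and 3 single out the
  second summand.\<close>

lemma wedge_phi_nonzero:
  "wedge [phi 3 0] [frame_vec 3 0 1] = 1"
  "wedge [phi 1 0, phi 3 0] [frame_vec 2 0 1, frame_vec 3 0 1] = 0"
  "wedge [phi 2 0, phi 3 0] [frame_vec 2 0 1, frame_vec 3 0 1] = 1"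
  "wedge [phi 1 0, phi 2 0, phi 3 0] [frame_vec 1 0 1, frame_vec 2 0 1, frame_vec 3 0 1] = 1"
  by (simp_all add: wedge_Cons cwedge_Cons wedge_Nil phi_frame_vec cwedge_linear)

theorem mainTheorem9:
  shows "(\<lambda>x. wedge [phi 3 x]) \<noteq> (\<lambda>x vs. 0)
       \<and> dbar_closed_p0 1 = cline (\<lambda>x. wedge [phi 3 x])
       \<and> (\<lambda>x vs. \<i> * wedge [phi 1 x, phi 3 x] vs + wedge [phi 2 x, phi 3 x] vs) \<noteq> (\<lambda>x vs. 0)
       \<and> dbar_closed_p0 2 = cline (\<lambda>x vs. \<i> * wedge [phi 1 x, phi 3 x] vs + wedge [phi 2 x, phi 3 x] vs)
       \<and> (\<lambda>x. wedge [phi 1 x, phi 2 x, phi 3 x]) \<noteq> (\<lambda>x vs. 0)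
       \<and> dbar_closed_p0 3 = cline (\<lambda>x. wedge [phi 1 x, phi 2 x, phi 3 x])"
proof (intro conjI dbar_closed_1_0 dbar_closed_2_0 dbar_closed_3_0 notI)
  assume "(\<lambda>x. wedge [phi 3 x]) = (\<lambda>x vs. 0)"
  from fun_cong[OF fun_cong[OF this, of 0], of "[frame_vec 3 0 1]"] show False
    by (simp add: wedge_phi_nonzero)
next
  assume "(\<lambda>x vs. \<i> * wedge [phi 1 x, phi 3 x] vs + wedge [phi 2 x, phi 3 x] vs) = (\<lambda>x vs. 0)"
  from fun_cong[OF fun_cong[OF this, of 0], of "[frame_vec 2 0 1, frame_vec 3 0 1]"] show False
    by (simp only: wedge_phi_nonzero) simp
next
  assume "(\<lambda>x. wedge [phi 1 x, phi 2 x, phi 3 x]) = (\<lambda>x vs. 0)"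
  from fun_cong[OF fun_cong[OF this, of 0], of "[frame_vec 1 0 1, frame_vec 2 0 1, frame_vec 3 0 1]"]
  show False by (simp only: wedge_phi_nonzero) simp
qed

end
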